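(* For every constant $\epsilon\in(0,1)$ and every constant $M>1$ there is a constant $\gamma=\gamma(\epsilon,M)>0$ such that the following holds. For $n$ sufficiently large and $\Delta>n/M$, for any (possibly adaptive) Builder strategy in the online edge-coloring game $\Phi(n,\Delta,\epsilon)$, the randomized greedy algorithm $\mathcal{A}$ wins (colors every edge of the resulting graph) with probability at least $1-2^{-\gamma\Delta}$.
   Context: The online edge-coloring game $\Phi(n,\Delta,\epsilon)$: start with the empty graph on a fixed set of $n$ vertices and a color set $\Gamma$ with $|\Gamma|=\lceil(1+\epsilon)\Delta\rceil$. The game lasts $m=\lfloor \Delta n/2\rfloor$ steps. At each step Builder adds an edge to the graph, keeping every vertex degree at most $\Delta$, or adds a null edge (an edge incident to no vertex, which can be given any color without affecting validity). Colorer then irrevocably assigns to the new edge a color from $\Gamma$ so that the coloring stays proper; if this is impossible the edge is left uncolored. Colorer wins if every edge is colored. A Builder strategy is adaptive if the edge chosen at each step may depend on the whole history so far, including the colors Colorer assigned. The free set of a vertex $v$ at a given moment is the set of colors of $\Gamma$ not yet used on a colored edge incident to $v$. The randomized greedy algorithm $\mathcal{A}$: when edge $(u,v)$ arrives, if the intersection of the free sets of $u$ and $v$ is nonempty, color the edge with a color chosen uniformly at random from that intersection; otherwise leave it uncolored. The probability is over the random choices of $\mathcal{A}$. *)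

theory Defs
  imports "HOL-Probability.Probability"
begin

text \<open>
  The vertex set is \<open>{..<n}\<close>. An edge is its set of endpoints: a genuine edge has
  exactly two endpoints and the null edge is \<open>{}\<close>. A history lists the steps in chronological
  order, each with the edge added by Builder and Colorer's response, where \<open>None\<close> means that
  the edge was left uncolored.
\<close>

type_synonym edge = "nat set"
type_synonym history = "(edge \<times> nat option) list"
type_synonym builder = "history \<Rightarrow> edge"
type_synonym colorer = "history \<Rightarrow> edge \<Rightarrow> nat option pmf"

definition palette :: "nat \<Rightarrow> real \<Rightarrow> nat set" where
  "palette \<Delta> \<epsilon> = {..<nat \<lceil>(1 + \<epsilon>) * real \<Delta>\<rceil>}"

definition num_steps :: "nat \<Rightarrow> nat \<Rightarrow> nat" where
  "num_steps n \<Delta> = nat \<lfloor>real \<Delta> * real n / 2\<rfloor>"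

definition graph_of :: "history \<Rightarrow> edge set" where
  "graph_of h = fst ` set h - {{}}"

definition vertex_degree :: "edge set \<Rightarrow> nat \<Rightarrow> nat" where
  "vertex_degree G v = card {e \<in> G. v \<in> e}"

text \<open>The graph is simple, so Builder may not repeat a genuine edge; the null edge may be repeated.\<close>

definition builder_move :: "nat \<Rightarrow> nat \<Rightarrow> history \<Rightarrow> edge \<Rightarrow> bool" where
  "builder_move n \<Delta> h e \<longleftrightarrow>
     e = {} \<or>
     (e \<subseteq> {..<n} \<and> card e = 2 \<and> e \<notin> graph_of h \<and>
      (\<forall>v<n. vertex_degree (insert e (graph_of h)) v \<le> \<Delta>))"

definition free_set :: "nat set \<Rightarrow> history \<Rightarrow> nat \<Rightarrow> nat set" where
  "free_set \<Gamma> h v = \<Gamma> - {c. \<exists>e. (e, Some c) \<in> set h \<and> v \<in> e}"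

text \<open>For the null edge this is all of \<open>\<Gamma>\<close>.\<close>

definition available :: "nat set \<Rightarrow> history \<Rightarrow> edge \<Rightarrow> nat set" where
  "available \<Gamma> h e = {c \<in> \<Gamma>. \<forall>v\<in>e. c \<in> free_set \<Gamma> h v}"

definition colorer_move :: "nat set \<Rightarrow> history \<Rightarrow> edge \<Rightarrow> nat option \<Rightarrow> bool" where
  "colorer_move \<Gamma> h e r \<longleftrightarrow>
     (case r of Some c \<Rightarrow> c \<in> available \<Gamma> h e | None \<Rightarrow> available \<Gamma> h e = {})"

text \<open>The histories that can arise when Builder follows \<open>B\<close> against an arbitrary Colorer.\<close>

inductive consistent_history :: "nat set \<Rightarrow> builder \<Rightarrow> history \<Rightarrow> bool"
  for \<Gamma> :: "nat set" and B :: builder where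
  start: "consistent_history \<Gamma> B []"
| step: "consistent_history \<Gamma> B h \<Longrightarrow> colorer_move \<Gamma> h (B h) r \<Longrightarrow>
         consistent_history \<Gamma> B (h @ [(B h, r)])"

definition builder_strategy :: "nat \<Rightarrow> nat \<Rightarrow> real \<Rightarrow> builder \<Rightarrow> bool" where
  "builder_strategy n \<Delta> \<epsilon> B \<longleftrightarrow>
     (\<forall>h. consistent_history (palette \<Delta> \<epsilon>) B h \<longrightarrow> length h < num_steps n \<Delta> \<longrightarrow>
          builder_move n \<Delta> h (B h))"

definition randomized_greedy :: "nat set \<Rightarrow> colorer" where
  "randomized_greedy \<Gamma> h e =
     (if available \<Gamma> h e = {} then return_pmf None
      else map_pmf Some (pmf_of_set (available \<Gamma> h e)))"

primrec play :: "builder \<Rightarrow> colorer \<Rightarrow> nat \<Rightarrow> history pmf" where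
  "play B A 0 = return_pmf []"
| "play B A (Suc t) =
     bind_pmf (play B A t) (\<lambda>h. map_pmf (\<lambda>r. h @ [(B h, r)]) (A h (B h)))"

definition game :: "nat \<Rightarrow> nat \<Rightarrow> builder \<Rightarrow> colorer \<Rightarrow> history pmf" where
  "game n \<Delta> B A = play B A (num_steps n \<Delta>)"

definition colorer_wins :: "history \<Rightarrow> bool" where
  "colorer_wins h \<longleftrightarrow> (\<forall>(e, r) \<in> set h. r \<noteq> None)"

end

theory Submission
  imports Defs "HOL-Real_Asymp.Real_Asymp"
begin

text \<open>
  If the free sets \<open>F\<^sub>w\<close> behaved like independent random subsets of \<open>\<Gamma>\<close>, then
  \<open>card (F\<^sub>u \<inter> F\<^sub>v)\<close> would be close to \<open>card F\<^sub>u * card F\<^sub>v / card \<Gamma>\<close>, which is linear in \<open>\<Delta>\<close>, and no edge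
  would ever be left uncolored. To control the deviation from this ideal, follow the density of a set
  \<open>D\<close> of colors in \<open>F\<^sub>w\<close>. It is a martingale plus a drift; at an edge \<open>{w, x}\<close> the drift is \<open>O(1 / \<Delta>)\<close>
  times the errors of the densities of \<open>F\<^sub>w \<inter> D\<close> and \<open>F\<^sub>w\<close> in \<open>F\<^sub>x\<close>. So the total drift at \<open>w\<close> is a sum of
  errors, over the neighbours \<open>x\<close> of \<open>w\<close>, with respect to a decreasing chain of color sets.
  The martingale part of such a sum has \<open>O(\<Delta>\<^sup>2)\<close> steps, because the graph is dense, and exceeds \<open>\<nu> \<Delta>\<close>
  with probability only \<open>exp (- \<Omega>(\<Delta>\<^sup>2))\<close>. This survives a union bound over all
  \<open>exp (O(\<Delta> log \<Delta>))\<close> chains and choices of times, which disposes of the adaptivity of Builder.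
  Deterministically, the errors are then amplified by a factor depending only on \<open>\<epsilon>\<close> and \<open>M\<close>.
  The failure probability is dominated by the martingales of the single pairs \<open>u, v\<close>, which have
  \<open>O(\<Delta>)\<close> steps each and deviate with probability \<open>exp (- \<Omega>(\<Delta>))\<close>.
\<close>

section \<open>Legal histories\<close>

definition legal :: "nat \<Rightarrow> nat \<Rightarrow> nat set \<Rightarrow> history \<Rightarrow> bool" where
  "legal n \<Delta> \<Gamma> h \<longleftrightarrow>
     (\<forall>s<length h. builder_move n \<Delta> (take s h) (fst (h ! s)) \<and>
        colorer_move \<Gamma> (take s h) (fst (h ! s)) (snd (h ! s)))"

lemma legal_snoc:
  "legal n \<Delta> \<Gamma> (h @ [x]) \<longleftrightarrow>
     legal n \<Delta> \<Gamma> h \<and> builder_move n \<Delta> h (fst x) \<and> colorer_move \<Gamma> h (fst x) (snd x)"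
  unfolding legal_def by (auto simp: less_Suc_eq nth_append)

lemma finite_available: "finite \<Gamma> \<Longrightarrow> finite (available \<Gamma> h e)"
  by (simp add: available_def)

lemma set_pmf_randomized_greedy:
  assumes "finite \<Gamma>"
  shows "set_pmf (randomized_greedy \<Gamma> h e) = {r. colorer_move \<Gamma> h e r}"
  using finite_available[OF assms, of h e]
  by (auto simp: randomized_greedy_def colorer_move_def split: option.splits)

lemma consistent_if_in_play:
  assumes "finite \<Gamma>" "h \<in> set_pmf (play B (randomized_greedy \<Gamma>) t)"
  shows "consistent_history \<Gamma> B h \<and> length h = t"
  using assms(2)
proof (induction t arbitrary: h)
  case 0
  then show ?case by (auto intro: consistent_history.start)
next
  case (Suc t)
  then show ?case
    by (auto simp: set_pmf_randomized_greedy[OF assms(1)] intro: consistent_history.step)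
qed

text \<open>Removes Builder's strategy from the deterministic half of the proof: that half treats
  one fixed history and needs only that each of its steps obeyed the rules.\<close>

lemma legal_if_in_play:
  assumes "builder_strategy n \<Delta> \<epsilon> B" "t \<le> num_steps n \<Delta>"
    and "h \<in> set_pmf (play B (randomized_greedy (palette \<Delta> \<epsilon>)) t)"
  shows "legal n \<Delta> (palette \<Delta> \<epsilon>) h"
  using assms(2,3)
proof (induction t arbitrary: h)
  case 0
  then show ?case by (auto simp: legal_def)
next
  case (Suc t)
  have fin: "finite (palette \<Delta> \<epsilon>)" by (simp add: palette_def)
  from Suc.prems obtain h' r where h': "h = h' @ [(B h', r)]"
      "h' \<in> set_pmf (play B (randomized_greedy (palette \<Delta> \<epsilon>)) t)"
      "colorer_move (palette \<Delta> \<epsilon>) h' (B h') r"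
    by (auto simp: set_pmf_randomized_greedy[OF fin])
  moreover have "builder_move n \<Delta> h' (B h')"
    using assms(1) consistent_if_in_play[OF fin h'(2)] Suc.prems(1)
    by (auto simp: builder_strategy_def)
  ultimately show ?case using Suc by (auto simp: legal_snoc)
qed

subsection \<open>Martingales along the game\<close>

text \<open>Conditional mean of the change under the uniform choice of color. When no color is
  available the quotient is 0 / 0 = 0.\<close>

definition avg :: "nat set \<Rightarrow> (history \<Rightarrow> edge \<Rightarrow> nat \<Rightarrow> real) \<Rightarrow> history \<Rightarrow> edge \<Rightarrow> real" where
  "avg \<Gamma> g h e = (\<Sum>c\<in>available \<Gamma> h e. g h e c) / card (available \<Gamma> h e)"

definition incr ::
  "nat set \<Rightarrow> (history \<Rightarrow> edge \<Rightarrow> nat \<Rightarrow> real) \<Rightarrow> history \<Rightarrow> edge \<times> nat option \<Rightarrow> real" where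
  "incr \<Gamma> g h x = (case snd x of None \<Rightarrow> 0 | Some c \<Rightarrow> g h (fst x) c - avg \<Gamma> g h (fst x))"

text \<open>
  The martingale part of a statistic that changes by \<open>g h e c\<close> when the edge \<open>e\<close> added after
  the history \<open>h\<close> receives the color \<open>c\<close>.
\<close>

definition noise :: "nat set \<Rightarrow> (history \<Rightarrow> edge \<Rightarrow> nat \<Rightarrow> real) \<Rightarrow> history \<Rightarrow> real" where
  "noise \<Gamma> g h = (\<Sum>s<length h. incr \<Gamma> g (take s h) (h ! s))"

lemma noise_snoc: "noise \<Gamma> g (h @ [x]) = noise \<Gamma> g h + incr \<Gamma> g h x"
  by (simp add: noise_def nth_append)

lemma incr_sum:
  "incr \<Gamma> (\<lambda>h e c. \<Sum>i\<in>I. g i h e c) h x = (\<Sum>i\<in>I. incr \<Gamma> (g i) h x)"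
  unfolding incr_def avg_def
  by (subst sum.swap) (auto simp: sum_subtractf sum_divide_distrib split: option.splits)

text \<open>With \<open>noise_scale\<close>, this makes a signed sum of the noises of all vertices a
  single martingale, as \<open>chain_tail\<close> needs.\<close>

lemma noise_sum: "noise \<Gamma> (\<lambda>h e c. \<Sum>i\<in>I. g i h e c) h = (\<Sum>i\<in>I. noise \<Gamma> (g i) h)"
  unfolding noise_def by (subst sum.swap) (simp add: incr_sum)

lemma incr_scale: "incr \<Gamma> (\<lambda>h e c. a * g h e c) h x = a * incr \<Gamma> g h x"
  unfolding incr_def avg_def
  by (auto simp: algebra_simps sum_distrib_left split: option.splits)

lemma noise_scale: "noise \<Gamma> (\<lambda>h e c. a * g h e c) h = a * noise \<Gamma> g h"
  unfolding noise_def by (simp add: incr_scale sum_distrib_left)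

text \<open>Hoeffding's lemma for a uniform choice: the values lie in an interval of length
  \<open>2 * \<beta>\<close>, and (2 \<beta>)^2 / 8 = \<beta>^2 / 2.\<close>

lemma nn_integral_exp_incr_le:
  assumes fin: "finite \<Gamma>" and l: "l > 0"
    and bnd: "\<And>c. c \<in> available \<Gamma> h e \<Longrightarrow> \<bar>g h e c\<bar> \<le> \<beta>"
  shows "(\<integral>\<^sup>+r. ennreal (exp (l * incr \<Gamma> g h (e, r))) \<partial>randomized_greedy \<Gamma> h e)
           \<le> ennreal (exp (l\<^sup>2 * \<beta>\<^sup>2 / 2))"
proof (cases "available \<Gamma> h e = {}")
  case True
  then show ?thesis
    by (simp add: randomized_greedy_def incr_def nn_integral_return_pmf)
next
  case False
  let ?A = "available \<Gamma> h e"
  have A: "finite ?A" using fin by (rule finite_available)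
  interpret interval_bounded_random_variable "pmf_of_set ?A" "\<lambda>c. g h e c" "-\<beta>" "\<beta>"
    by (unfold_locales)
       (use bnd False A in \<open>auto simp: AE_measure_pmf_iff abs_le_iff minus_le_iff\<close>)
  have ex: "measure_pmf.expectation (pmf_of_set ?A) (\<lambda>c. g h e c) = avg \<Gamma> g h e"
    using False A by (simp add: integral_pmf_of_set avg_def)
  have "(\<integral>\<^sup>+c. ennreal (exp (l * (g h e c - avg \<Gamma> g h e))) \<partial>pmf_of_set ?A)
          \<le> ennreal (exp (l\<^sup>2 * (\<beta> - - \<beta>)\<^sup>2 / 8))"
    using Hoeffdings_lemma_nn_integral[OF l] unfolding ex by simp
  also have "(\<beta> - - \<beta>)\<^sup>2 / 8 = \<beta>\<^sup>2 / 2" by (simp add: power2_eq_square)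
  then have "l\<^sup>2 * (\<beta> - - \<beta>)\<^sup>2 / 8 = l\<^sup>2 * \<beta>\<^sup>2 / 2" by (metis times_divide_eq_right)
  finally show ?thesis using False
    by (simp add: randomized_greedy_def incr_def)
qed

text \<open>The step bound \<beta> may depend on the history and the edge, so the sum of its squares
  is random. Subtracting it inside the exponent compensates each step exactly by the Hoeffding
  bound.\<close>

lemma noise_supermartingale:
  assumes fin: "finite \<Gamma>" and l: "l > 0"
    and bnd: "\<And>s h c. \<lbrakk>s < t; h \<in> set_pmf (play B (randomized_greedy \<Gamma>) s);
                c \<in> available \<Gamma> h (B h)\<rbrakk> \<Longrightarrow> \<bar>g h (B h) c\<bar> \<le> \<beta> h (B h)"
  shows "(\<integral>\<^sup>+h. ennreal (exp (l * noise \<Gamma> g h -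
             l\<^sup>2 / 2 * (\<Sum>s<length h. (\<beta> (take s h) (fst (h ! s)))\<^sup>2)))
           \<partial>play B (randomized_greedy \<Gamma>) t) \<le> 1"
  using bnd
proof (induction t)
  case 0
  then show ?case by (simp add: nn_integral_return_pmf noise_def)
next
  case (Suc t)
  let ?A = "randomized_greedy \<Gamma>"
  let ?Q = "\<lambda>h. \<Sum>s<length h. (\<beta> (take s h) (fst (h ! s)))\<^sup>2"
  let ?X = "\<lambda>h. l * noise \<Gamma> g h - l\<^sup>2 / 2 * ?Q h"
  have "(\<integral>\<^sup>+h. ennreal (exp (?X h)) \<partial>play B ?A (Suc t))
      = (\<integral>\<^sup>+h. \<integral>\<^sup>+r. ennreal (exp (?X (h @ [(B h, r)]))) \<partial>?A h (B h) \<partial>play B ?A t)"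
    by (simp add: nn_integral_bind_pmf)
  also have "\<dots> \<le> (\<integral>\<^sup>+h. ennreal (exp (?X h)) \<partial>play B ?A t)"
  proof (rule nn_integral_mono_AE, unfold AE_measure_pmf_iff, intro ballI)
    fix h assume h: "h \<in> set_pmf (play B ?A t)"
    define K where "K = ?X h - l\<^sup>2 * (\<beta> h (B h))\<^sup>2 / 2"
    have Q: "?Q (h @ [(B h, r)]) = ?Q h + (\<beta> h (B h))\<^sup>2" for r
      by (simp add: nth_append)
    have X: "ennreal (exp (?X (h @ [(B h, r)]))) =
        ennreal (exp K) * ennreal (exp (l * incr \<Gamma> g h (B h, r)))" for r
      unfolding Q by (simp add: noise_snoc K_def algebra_simps flip: ennreal_mult exp_add)
    have "(\<integral>\<^sup>+r. ennreal (exp (?X (h @ [(B h, r)]))) \<partial>?A h (B h)) =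
        ennreal (exp K) * (\<integral>\<^sup>+r. ennreal (exp (l * incr \<Gamma> g h (B h, r))) \<partial>?A h (B h))"
      unfolding X by (rule nn_integral_cmult) simp
    also have "\<dots> \<le> ennreal (exp K) * ennreal (exp (l\<^sup>2 * (\<beta> h (B h))\<^sup>2 / 2))"
      by (intro mult_left_mono nn_integral_exp_incr_le fin l)
         (use Suc.prems[OF _ h] in auto)
    also have "\<dots> = ennreal (exp (?X h))"
      by (simp add: K_def algebra_simps flip: ennreal_mult exp_add)
    finally show "(\<integral>\<^sup>+r. ennreal (exp (?X (h @ [(B h, r)]))) \<partial>?A h (B h)) \<le> ennreal (exp (?X h))" .
  qed
  also have "\<dots> \<le> 1"
    by (intro Suc.IH Suc.prems less_SucI)
  finally show ?case .
qed

text \<open>Azuma's inequality, with the sum of squared step bounds controlled only along whole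
  plays. Thus a statistic that moves at few steps, unknown in advance, still gets a small
  \<open>V\<close>.\<close>

theorem noise_tail:
  assumes fin: "finite \<Gamma>" and "a > 0" "V > 0"
    and bnd: "\<And>s h c. \<lbrakk>s < t; h \<in> set_pmf (play B (randomized_greedy \<Gamma>) s);
                c \<in> available \<Gamma> h (B h)\<rbrakk> \<Longrightarrow> \<bar>g h (B h) c\<bar> \<le> \<beta> h (B h)"
    and V: "\<And>h. h \<in> set_pmf (play B (randomized_greedy \<Gamma>) t) \<Longrightarrow>
                (\<Sum>s<length h. (\<beta> (take s h) (fst (h ! s)))\<^sup>2) \<le> V"
  shows "measure_pmf.prob (play B (randomized_greedy \<Gamma>) t) {h. noise \<Gamma> g h \<ge> a}
           \<le> exp (- (a\<^sup>2 / (2 * V)))"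
proof -
  let ?P = "play B (randomized_greedy \<Gamma>) t"
  let ?Q = "\<lambda>h. \<Sum>s<length h. (\<beta> (take s h) (fst (h ! s)))\<^sup>2"
  \<comment> \<open>This value maximises \<open>l * a - l\<^sup>2 / 2 * V\<close>, giving a^2 / (2
    V).\<close>
  define l where "l = a / V"
  have l: "l > 0" using assms by (simp add: l_def)
  define K where "K = exp (- (l * a - l\<^sup>2 / 2 * V))"
  have "emeasure ?P {h. noise \<Gamma> g h \<ge> a} = (\<integral>\<^sup>+h. indicator {h. noise \<Gamma> g h \<ge> a} h \<partial>?P)"
    by (subst nn_integral_indicator) auto
  also have "\<dots> \<le> (\<integral>\<^sup>+h. ennreal K * ennreal (exp (l * noise \<Gamma> g h - l\<^sup>2 / 2 * ?Q h)) \<partial>?P)"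
  proof (rule nn_integral_mono_AE, unfold AE_measure_pmf_iff, intro ballI)
    fix h assume h: "h \<in> set_pmf ?P"
    have "1 \<le> K * exp (l * noise \<Gamma> g h - l\<^sup>2 / 2 * ?Q h)" if "noise \<Gamma> g h \<ge> a"
    proof -
      have "l * a \<le> l * noise \<Gamma> g h" using that l by simp
      moreover have "l\<^sup>2 / 2 * ?Q h \<le> l\<^sup>2 / 2 * V" using V[OF h] by (intro mult_left_mono) auto
      ultimately show ?thesis by (simp add: K_def flip: exp_add)
    qed
    then show "indicator {h. noise \<Gamma> g h \<ge> a} h
        \<le> ennreal K * ennreal (exp (l * noise \<Gamma> g h - l\<^sup>2 / 2 * ?Q h))"
      by (auto simp: indicator_def K_def simp flip: ennreal_mult)
  qed
  also have "\<dots> = ennreal K * (\<integral>\<^sup>+h. ennreal (exp (l * noise \<Gamma> g h - l\<^sup>2 / 2 * ?Q h)) \<partial>?P)"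
    by (rule nn_integral_cmult) simp
  also have "\<dots> \<le> ennreal K * 1"
    by (intro mult_left_mono noise_supermartingale fin l bnd) auto
  finally have "emeasure ?P {h. noise \<Gamma> g h \<ge> a} \<le> ennreal K" by simp
  then have "measure ?P {h. noise \<Gamma> g h \<ge> a} \<le> K"
    by (simp add: measure_pmf.emeasure_eq_measure K_def)
  also have "K = exp (- (a\<^sup>2 / (2 * V)))"
    using \<open>V > 0\<close> by (simp add: K_def l_def power2_eq_square field_simps)
  finally show ?thesis .
qed

subsection \<open>A good history is won\<close>

text \<open>
  Let \<open>F\<^sub>w\<close> be the free set of \<open>w\<close>. When an edge at \<open>w\<close> receives the color \<open>c\<close>, the density
  \<open>card (F\<^sub>w \<inter> D) / card F\<^sub>w\<close> changes by \<open>vstat\<close> plus a quantity independent of \<open>c\<close>; likewise \<open>pstat\<close> for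
  \<open>card (F\<^sub>u \<inter> F\<^sub>v) / (card F\<^sub>u * card F\<^sub>v)\<close> and an edge at \<open>u\<close> that avoids \<open>v\<close>. Both stop at time \<open>t\<close>.
\<close>

definition vstat :: "nat set \<Rightarrow> nat \<Rightarrow> nat \<Rightarrow> nat set \<Rightarrow> history \<Rightarrow> edge \<Rightarrow> nat \<Rightarrow> real" where
  "vstat \<Gamma> w t D h e c =
     (if length h < t \<and> w \<in> e then - of_bool (c \<in> D) / (real (card (free_set \<Gamma> h w)) - 1) else 0)"

definition pstat :: "nat set \<Rightarrow> nat \<Rightarrow> nat \<Rightarrow> nat \<Rightarrow> history \<Rightarrow> edge \<Rightarrow> nat \<Rightarrow> real" where
  "pstat \<Gamma> u v t h e c =
     (if length h < t \<and> u \<in> e \<and> v \<notin> e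
      then - of_bool (c \<in> free_set \<Gamma> h v) /
             ((real (card (free_set \<Gamma> h u)) - 1) * real (card (free_set \<Gamma> h v)))
      else 0)"

text \<open>Lets \<open>chain_nz_le\<close> encode the times at which a color belongs to a
  decreasing chain by their number.\<close>

lemma down_closed_eq_lessThan_card:
  fixes A :: "nat set"
  assumes "finite A" "\<And>i j. j \<in> A \<Longrightarrow> i \<le> j \<Longrightarrow> i \<in> A"
  shows "A = {..<card A}"
proof (intro set_eqI iffI)
  fix s assume "s \<in> A"
  then have "{..s} \<subseteq> A" using assms(2) by auto
  from card_mono[OF assms(1) this] show "s \<in> {..<card A}" by simp
next
  fix s assume s: "s \<in> {..<card A}"
  show "s \<in> A"
  proof (rule ccontr)
    assume "s \<notin> A"
    then have "A \<subseteq> {..<s}" using assms(2) by (meson lessThan_iff not_le subsetI)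
    from card_mono[OF _ this] s show False by simp
  qed
qed

lemma free_set_snoc:
  "free_set \<Gamma> (h @ [x]) v =
     (if v \<in> fst x then free_set \<Gamma> h v - set_option (snd x) else free_set \<Gamma> h v)"
  by (cases x; cases "snd x") (auto simp: free_set_def)

section \<open>Degrees and free sets along a fixed legal history\<close>

locale legal_history =
  fixes n \<Delta> :: nat and \<Gamma> :: "nat set" and \<epsilon> :: real and h :: history
  assumes fin: "finite \<Gamma>" and eps: "0 < \<epsilon>" and Delta: "0 < \<Delta>"
    and card_ge: "(1 + \<epsilon>) * real \<Delta> \<le> real (card \<Gamma>)"
    and card_le: "card \<Gamma> \<le> 3 * \<Delta>"
    and legal: "legal n \<Delta> \<Gamma> h"
begin

abbreviation "m \<equiv> length h"
definition "E s = fst (h ! s)"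
definition "col s = snd (h ! s)"
definition "F s v = free_set \<Gamma> (take s h) v"
definition "f s v = real (card (F s v))"
definition "avail s = available \<Gamma> (take s h) (E s)"
text \<open>Neighbours of \<open>w\<close> are indexed by the arrival times of their edges, so that
  each comes with the moment at which its free set matters.\<close>

definition "nb t w = {s. s < t \<and> w \<in> E s}"
definition "other s w = the_elem (E s - {w})"

lemma F_0: "F 0 v = \<Gamma>"
  by (simp add: F_def free_set_def)

lemma F_Suc:
  assumes "s < m"
  shows "F (Suc s) v = (if v \<in> E s then F s v - set_option (col s) else F s v)"
  using assms by (simp add: F_def E_def col_def take_Suc_conv_app_nth free_set_snoc)

lemma F_subset: "F s v \<subseteq> \<Gamma>"
  by (auto simp: F_def free_set_def)

lemma finite_F [simp]: "finite (F s v)"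
  using F_subset fin by (rule finite_subset)

lemma F_antimono: "s \<le> t \<Longrightarrow> F t v \<subseteq> F s v"
  using set_take_subset_set_take[of s t h] by (auto simp: F_def free_set_def)

lemma edge_cases:
  assumes "s < m"
  obtains "E s = {}" | u v where "u \<noteq> v" "u < n" "v < n" "E s = {u, v}"
  using assms legal unfolding legal_def builder_move_def E_def
  by (metis card_2_iff insert_subset lessThan_iff)

lemma edge_obtain:
  assumes "s < m" "w \<in> E s"
  obtains "other s w \<noteq> w" "other s w < n" "w < n" "E s = {w, other s w}"
proof -
  from assms(1) show thesis
  proof (cases rule: edge_cases)
    case (2 u v)
    then consider "w = u" "other s w = v" | "w = v" "other s w = u"
      using assms(2) by (auto simp: other_def insert_Diff_if)
    then show thesis using 2 that by cases auto
  qed (use assms in auto)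
qed

lemma simple:
  assumes "s < t" "t < m" "E s = E t"
  shows "E t = {}"
proof -
  have "E t = {} \<or> E t \<notin> graph_of (take t h)"
    using legal assms(2) by (auto simp: legal_def builder_move_def E_def)
  moreover have "E s \<in> fst ` set (take t h)"
    unfolding E_def using assms by (intro imageI) (auto simp: in_set_conv_nth intro!: exI[of _ s])
  ultimately show ?thesis using assms(3) by (auto simp: graph_of_def)
qed

lemma inj_on_E: "t \<le> m \<Longrightarrow> inj_on E (nb t w)"
  by (intro inj_onI) (metis (no_types, lifting) nb_def simple mem_Collect_eq empty_iff
      linorder_neqE_nat order_less_le_trans)

lemma inj_on_other: "t \<le> m \<Longrightarrow> inj_on (\<lambda>s. other s w) (nb t w)"
proof (intro inj_onI)
  fix s s' assume *: "t \<le> m" "s \<in> nb t w" "s' \<in> nb t w" "other s w = other s' w"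
  then have "s < m" "s' < m" "w \<in> E s" "w \<in> E s'" by (auto simp: nb_def)
  then have "E s = E s'" using *(4) edge_obtain by metis
  with inj_on_E[OF *(1)] *(2,3) show "s = s'" by (auto dest: inj_onD)
qed

lemma finite_nb [simp]: "finite (nb t w)"
  by (simp add: nb_def)

text \<open>Builder's degree condition at the last edge of \<open>w\<close> before time
  \<open>t\<close> already counts every edge in \<open>nb t w\<close>.\<close>

lemma card_nb_le:
  assumes "t \<le> m"
  shows "card (nb t w) \<le> \<Delta>"
proof (cases "nb t w = {}")
  case False
  define s where "s = Max (nb t w)"
  have s: "s \<in> nb t w" "\<And>r. r \<in> nb t w \<Longrightarrow> r \<le> s"
    using False by (auto simp: s_def)
  then have sm: "s < m" and ws: "w \<in> E s" using assms by (auto simp: nb_def)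
  have "w < n" using sm ws by (rule edge_obtain)
  then have d: "vertex_degree (insert (E s) (graph_of (take s h))) w \<le> \<Delta>"
    using legal sm ws by (auto simp: legal_def builder_move_def E_def)
  have "E ` nb t w \<subseteq> {e \<in> insert (E s) (graph_of (take s h)). w \<in> e}"
  proof
    fix e assume "e \<in> E ` nb t w"
    then obtain r where r: "e = E r" "r \<in> nb t w" by auto
    have "r = s \<or> r < s" using s(2)[OF r(2)] by auto
    moreover have "E r \<in> fst ` set (take s h)" if "r < s"
      unfolding E_def using that sm
      by (intro imageI) (auto simp: in_set_conv_nth intro!: exI[of _ r])
    ultimately show "e \<in> {e \<in> insert (E s) (graph_of (take s h)). w \<in> e}"
      using r by (auto simp: nb_def graph_of_def)
  qed
  moreover have "finite {e \<in> insert (E s) (graph_of (take s h)). w \<in> e}"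
    by (simp add: graph_of_def)
  ultimately have "card (E ` nb t w) \<le> vertex_degree (insert (E s) (graph_of (take s h))) w"
    unfolding vertex_degree_def by (rule card_mono[rotated])
  then show ?thesis using d card_image[OF inj_on_E[OF assms]] by simp
qed simp

lemma nb_Suc: "nb (Suc t) w = (if w \<in> E t then insert t (nb t w) else nb t w)"
  by (auto simp: nb_def less_Suc_eq)

lemma not_in_nb [simp]: "t \<notin> nb t w"
  by (simp add: nb_def)

lemma card_F_ge: "t \<le> m \<Longrightarrow> card \<Gamma> \<le> card (F t w) + card (nb t w)"
proof (induction t)
  case 0
  then show ?case by (simp add: F_0)
next
  case (Suc t)
  have "card (F t w) \<le> Suc (card (F t w - set_option (col t)))"
    using diff_card_le_card_Diff[of "set_option (col t)" "F t w"]
    by (cases "col t") auto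
  then show ?case using Suc by (auto simp: F_Suc nb_Suc)
qed

lemma f_ge: "t \<le> m \<Longrightarrow> \<epsilon> * \<Delta> \<le> f t w"
  using card_F_ge[of t w] card_nb_le[of t w] card_ge
  by (simp add: f_def algebra_simps)

text \<open>The subtracted 1 is affordable because edge \<open>t\<close> itself uses up one of the
  \<Delta> edges allowed at \<open>w\<close>: at most \<Delta> - 1 came before it.\<close>

lemma f_ge': "t < m \<Longrightarrow> w \<in> E t \<Longrightarrow> \<epsilon> * \<Delta> \<le> f t w - 1"
  using card_F_ge[of t w] card_nb_le[of "Suc t" w] card_ge
  by (simp add: f_def algebra_simps nb_Suc)

lemma eD: "0 < \<epsilon> * \<Delta>"
  using eps Delta by simp

lemma f_pos: "t \<le> m \<Longrightarrow> 0 < f t w"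
  using f_ge[of t w] eD by linarith

lemma f_pos': "t < m \<Longrightarrow> w \<in> E t \<Longrightarrow> 0 < f t w - 1"
  using f_ge'[of t w] eD by linarith

lemma card_Gamma_pos: "0 < card \<Gamma>"
  using card_ge eD Delta by (auto simp: algebra_simps intro!: Nat.gr0I)

lemma avail_edge: "E s = {u, v} \<Longrightarrow> avail s = F s u \<inter> F s v"
  using F_subset by (auto simp: avail_def available_def F_def)

lemma col_avail: "s < m \<Longrightarrow> col s = Some c \<Longrightarrow> c \<in> avail s"
  using legal by (auto simp: legal_def colorer_move_def col_def avail_def E_def split: option.splits)

lemma col_None: "s < m \<Longrightarrow> col s = None \<Longrightarrow> avail s = {}"
  using legal by (auto simp: legal_def colorer_move_def col_def avail_def E_def split: option.splits)

section \<open>Densities of color sets: noise, drift and error\<close>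

text \<open>
  \<open>q t w D\<close> is the density of \<open>D\<close> in the free set of \<open>w\<close> and \<open>prop s D\<close> the
  probability that the color of the \<open>s\<close>-th edge falls into \<open>D\<close>. With these normalisations \<open>q\<close> has no
  drift at an edge for which \<open>prop s D = q s w D\<close>, so that only the error \<open>er\<close> of the other
  endpoint enters \<open>drift\<close>.
\<close>

definition "q t w D = real (card (F t w \<inter> D)) / f t w"
definition "er t w D = q t w D - real (card D) / real (card \<Gamma>)"
definition "prop s D = real (card (avail s \<inter> D)) / real (card (avail s))"
definition "drift w t D =
  (\<Sum>s\<in>nb t w. if col s = None then 0 else (q s w D - prop s D) / (f s w - 1))"
definition "nz w t D = noise \<Gamma> (vstat \<Gamma> w t D) h"

lemma finite_avail [simp]: "finite (avail s)"
  by (simp add: avail_def finite_available fin)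

text \<open>The cut-off at \<open>t\<close> inside \<open>vstat\<close> lets the noise up to an
  intermediate time be read off from the full history.\<close>

lemma nz_eq:
  assumes "t \<le> m"
  shows "nz w t D = (\<Sum>s\<in>nb t w. case col s of None \<Rightarrow> 0
           | Some c \<Rightarrow> (prop s D - of_bool (c \<in> D)) / (f s w - 1))"
  unfolding nz_def noise_def
proof (rule sum.mono_neutral_cong_right)
  show "nb t w \<subseteq> {..<m}" using assms by (auto simp: nb_def)
  show "\<forall>s\<in>{..<m} - nb t w. incr \<Gamma> (vstat \<Gamma> w t D) (take s h) (h ! s) = 0"
    by (auto simp: nb_def E_def incr_def vstat_def avg_def split: option.splits)
  fix s assume s: "s \<in> nb t w"
  then have sm: "s < m" using assms by (auto simp: nb_def)
  have v: "vstat \<Gamma> w t D (take s h) (E s) c = - of_bool (c \<in> D) / (f s w - 1)" for c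
    using s sm by (simp add: vstat_def nb_def f_def F_def)
  have "avg \<Gamma> (vstat \<Gamma> w t D) (take s h) (E s) = - prop s D / (f s w - 1)"
    unfolding avg_def v prop_def avail_def[symmetric]
    by (simp add: sum_negf flip: sum_divide_distrib)
  then show "incr \<Gamma> (vstat \<Gamma> w t D) (take s h) (h ! s) =
      (case col s of None \<Rightarrow> 0 | Some c \<Rightarrow> (prop s D - of_bool (c \<in> D)) / (f s w - 1))"
    using v by (auto simp: incr_def col_def E_def diff_divide_distrib split: option.splits)
qed simp

lemma card_F_Suc_Int:
  assumes "s < m" "w \<in> E s" "col s = Some c"
  shows "real (card (F (Suc s) w \<inter> D)) = real (card (F s w \<inter> D)) - of_bool (c \<in> D)"
proof -
  have c: "c \<in> F s w"
    using col_avail[OF assms(1,3)] assms(2) by (auto simp: avail_def available_def F_def)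
  have eq: "F (Suc s) w \<inter> D = F s w \<inter> D - {c}"
    using assms by (auto simp: F_Suc)
  show ?thesis
  proof (cases "c \<in> D")
    case True
    then have "c \<in> F s w \<inter> D" using c by simp
    then have "card (F s w \<inter> D) > 0" by (auto simp: card_gt_0_iff)
    then show ?thesis using True c unfolding eq
      by (simp add: card_Diff_singleton of_nat_diff)
  next
    case False
    then have "F s w \<inter> D - {c} = F s w \<inter> D" by auto
    then show ?thesis using False eq by simp
  qed
qed

lemma f_Suc:
  assumes "s < m" "w \<in> E s" "col s = Some c"
  shows "f (Suc s) w = f s w - 1"
  using card_F_Suc_Int[OF assms, of \<Gamma>] col_avail[OF assms(1,3)] F_subset
  by (simp add: f_def Int_absorb2 avail_def available_def)

text \<open>The parameter \<open>p\<close> cancels. Taking for \<open>p\<close> the conditional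
  probability of \<open>d = 1\<close> separates a mean-zero term from a drift term.\<close>

lemma quotient_step:
  fixes a f p d :: real
  assumes "f > 0" "f - 1 > 0"
  shows "(a - d) / (f - 1) = a / f + (p - d) / (f - 1) + (a / f - p) / (f - 1)"
  using assms by (simp add: divide_simps) (simp add: algebra_simps)

text \<open>A Doob decomposition: the error is 0 at time 0, when every free set is \<Gamma>, and
  each colored edge at \<open>w\<close> contributes one \<open>quotient_step\<close>.\<close>

lemma er_eq_noise_plus_drift:
  assumes "t \<le> m" "D \<subseteq> \<Gamma>"
  shows "er t w D = nz w t D + drift w t D"
  using assms(1)
proof (induction t)
  case 0
  have "\<Gamma> \<inter> D = D" using assms(2) by auto
  then show ?case
    by (simp add: nz_eq er_def q_def drift_def F_0 f_def) (simp add: nb_def)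
next
  case (Suc t)
  then have t: "t < m" and IH: "er t w D = nz w t D + drift w t D" by auto
  show ?case
  proof (cases "w \<in> E t \<and> col t \<noteq> None")
    case False
    then have "F (Suc t) w = F t w" using t by (auto simp: F_Suc)
    then have "er (Suc t) w D = er t w D" by (simp add: er_def q_def f_def)
    then show ?thesis using IH t False by (auto simp: nz_eq drift_def nb_Suc)
  next
    case True
    then obtain c where w: "w \<in> E t" and c: "col t = Some c" by auto
    have "q (Suc t) w D = q t w D + (prop t D - of_bool (c \<in> D)) / (f t w - 1)
        + (q t w D - prop t D) / (f t w - 1)"
      unfolding q_def f_Suc[OF t w c] card_F_Suc_Int[OF t w c]
      by (rule quotient_step) (use f_pos f_pos' t w in auto)
    then show ?thesis using IH t w c by (simp add: nz_eq drift_def nb_Suc er_def)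
  qed
qed

text \<open>The common free set has at least half the size that independent random sets would give,
  which bounds the denominator of \<open>prop\<close> from below.\<close>

definition "good s \<longleftrightarrow> (\<forall>u v. u \<noteq> v \<and> E s = {u, v} \<longrightarrow>
   f s u * f s v / (2 * card \<Gamma>) \<le> card (F s u \<inter> F s v))"

text \<open>\<open>prop s D\<close> is the quotient of the densities of
  \<open>F s w \<inter> D\<close> and \<open>F s w\<close> in \<open>F s x\<close>, and equals
  \<open>q s w D\<close> if both errors vanish. By \<open>good\<close> the denominator is at least
  \<open>f s w / (2 * card \<Gamma>)\<close>, hence at least \<epsilon> / 6.\<close>

lemma q_minus_prop_le:
  assumes s: "s < m" and w: "w \<in> E s" and "good s" and D: "D \<subseteq> \<Gamma>"
  defines "x \<equiv> other s w"
  shows "\<bar>q s w D - prop s D\<bar> \<le> 6 / \<epsilon> * (\<bar>er s x (F s w \<inter> D)\<bar> + \<bar>er s x (F s w)\<bar>)"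
proof -
  have x: "x \<noteq> w" "E s = {w, x}" using edge_obtain[OF s w] by (auto simp: x_def)
  define N where "N = real (card \<Gamma>)"
  have N: "0 < N" "N \<le> 3 * \<Delta>" using card_Gamma_pos card_le by (auto simp: N_def)
  define q1 where "q1 = q s x (F s w \<inter> D)"
  define q2 where "q2 = q s x (F s w)"
  have fp: "f s x > 0" "f s w > 0" using s by (auto intro!: f_pos)
  have "f s w * f s x / (2 * N) \<le> card (F s w \<inter> F s x)"
    using \<open>good s\<close> x unfolding good_def N_def by (auto dest: spec[of _ w])
  then have "f s w / (2 * N) \<le> q2"
    using fp N by (simp add: q2_def q_def field_simps Int_commute)
  moreover have "\<epsilon> / 6 \<le> f s w / (2 * N)"
  proof -
    have "\<epsilon> * (2 * N) \<le> \<epsilon> * (2 * (3 * \<Delta>))" using N eps by (intro mult_left_mono) auto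
    also have "\<dots> \<le> 6 * f s w" using f_ge[of s w] s by simp
    finally show ?thesis using N by (simp add: field_simps)
  qed
  ultimately have q2: "\<epsilon> / 6 \<le> q2" by linarith
  have q2p: "q2 > 0" using q2 eps by linarith
  have "prop s D = q1 / q2"
    using fp by (simp add: prop_def q1_def q2_def q_def avail_edge[OF x(2)] Int_ac)
  moreover have "er s x (F s w) = q2 - f s w / N"
    by (simp add: er_def q2_def N_def f_def)
  moreover have "er s x (F s w \<inter> D) = q1 - q s w D * f s w / N"
    using fp by (simp add: er_def q1_def q_def N_def)
  ultimately have "(q s w D - prop s D) * q2 = q s w D * er s x (F s w) - er s x (F s w \<inter> D)"
    using q2p by (simp add: left_diff_distrib right_diff_distrib)
  then have "\<bar>q s w D - prop s D\<bar> * q2 = \<bar>q s w D * er s x (F s w) - er s x (F s w \<inter> D)\<bar>"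
    using q2p by (metis abs_mult abs_of_pos)
  also have "\<dots> \<le> \<bar>q s w D\<bar> * \<bar>er s x (F s w)\<bar> + \<bar>er s x (F s w \<inter> D)\<bar>"
    by (simp flip: abs_mult)
  also have "\<bar>q s w D\<bar> \<le> 1"
    using fp card_mono[of "F s w" "F s w \<inter> D"] by (simp add: q_def f_def)
  then have "\<bar>q s w D\<bar> * \<bar>er s x (F s w)\<bar> \<le> \<bar>er s x (F s w)\<bar>"
    by (simp add: mult_left_le_one_le)
  finally have *: "\<bar>q s w D - prop s D\<bar> * q2 \<le> \<bar>er s x (F s w \<inter> D)\<bar> + \<bar>er s x (F s w)\<bar>"
    by simp
  have "\<bar>q s w D - prop s D\<bar> * (\<epsilon> / 6) \<le> \<bar>q s w D - prop s D\<bar> * q2"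
    using q2 by (intro mult_left_mono) auto
  with * have "\<bar>q s w D - prop s D\<bar> * (\<epsilon> / 6) \<le> \<bar>er s x (F s w \<inter> D)\<bar> + \<bar>er s x (F s w)\<bar>"
    by linarith
  then show ?thesis using eps by (simp add: field_simps)
qed

text \<open>The factor 6 / \<epsilon> of \<open>q_minus_prop_le\<close> times the bound 1 /
  (\<epsilon> \<Delta>) on \<open>1 / (f s w - 1)\<close>.\<close>

definition "b = 6 / (\<epsilon>\<^sup>2 * \<Delta>)"

lemma b_pos: "b > 0"
  using eps Delta by (simp add: b_def)

lemma drift_term_le:
  assumes s: "s < m" and w: "w \<in> E s" and "good s" and D: "D \<subseteq> \<Gamma>"
  shows "\<bar>(q s w D - prop s D) / (f s w - 1)\<bar>
     \<le> b * (\<bar>er s (other s w) (F s w \<inter> D)\<bar> + \<bar>er s (other s w) (F s w)\<bar>)"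
proof -
  let ?S = "\<bar>er s (other s w) (F s w \<inter> D)\<bar> + \<bar>er s (other s w) (F s w)\<bar>"
  have "\<bar>(q s w D - prop s D) / (f s w - 1)\<bar> = \<bar>q s w D - prop s D\<bar> / (f s w - 1)"
    using f_pos'[OF s w] by simp
  also have "\<dots> \<le> (6 / \<epsilon> * ?S) / (\<epsilon> * \<Delta>)"
    using q_minus_prop_le[OF assms] f_ge'[OF s w] eD eps by (intro frac_le) auto
  also have "\<dots> = b * ?S" by (simp add: b_def power2_eq_square)
  finally show ?thesis .
qed

text \<open>Both families of color sets on the right decrease as \<open>s\<close> grows, so the
  chain bounds apply to each sum.\<close>

lemma drift_le:
  assumes t: "t \<le> m" and "\<And>s. s < t \<Longrightarrow> good s" and D: "D \<subseteq> \<Gamma>"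
  shows "\<bar>drift w t D\<bar> \<le> b * ((\<Sum>s\<in>nb t w. \<bar>er s (other s w) (F s w \<inter> D)\<bar>)
           + (\<Sum>s\<in>nb t w. \<bar>er s (other s w) (F s w)\<bar>))"
proof -
  have "\<bar>drift w t D\<bar> \<le> (\<Sum>s\<in>nb t w.
      b * (\<bar>er s (other s w) (F s w \<inter> D)\<bar> + \<bar>er s (other s w) (F s w)\<bar>))"
    unfolding drift_def
  proof (intro order_trans[OF sum_abs] sum_mono)
    fix s assume "s \<in> nb t w"
    then have s: "s < m" "w \<in> E s" "s < t" using t by (auto simp: nb_def)
    show "\<bar>if col s = None then 0 else (q s w D - prop s D) / (f s w - 1)\<bar>
      \<le> b * (\<bar>er s (other s w) (F s w \<inter> D)\<bar> + \<bar>er s (other s w) (F s w)\<bar>)"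
      using drift_term_le[OF s(1,2) assms(2)[OF s(3)] D] b_pos by auto
  qed
  then show ?thesis by (simp add: sum.distrib flip: sum_distrib_left)
qed

lemma nb_m: "t \<le> m \<Longrightarrow> s \<in> nb t w \<Longrightarrow> s < m \<and> w \<in> E s \<and> s < t"
  by (auto simp: nb_def)

lemma sum_other_le:
  fixes g :: "nat \<Rightarrow> real"
  assumes t: "t \<le> m" and "\<And>x. 0 \<le> g x"
    and le: "\<And>s. s \<in> nb t w \<Longrightarrow> k s \<le> g (other s w)"
  shows "(\<Sum>s\<in>nb t w. k s) \<le> (\<Sum>x<n. g x)"
proof -
  have "(\<Sum>s\<in>nb t w. k s) \<le> (\<Sum>s\<in>nb t w. g (other s w))"
    by (intro sum_mono le)
  also have "\<dots> = (\<Sum>x\<in>(\<lambda>s. other s w) ` nb t w. g x)"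
    by (simp add: sum.reindex[OF inj_on_other[OF t]])
  also have "\<dots> \<le> (\<Sum>x<n. g x)"
    using assms edge_obtain nb_m[OF t] by (intro sum_mono2) (auto, metis)
  finally show ?thesis .
qed

subsection \<open>Propagation of errors\<close>

text \<open>
  \<open>y \<beta> t w\<close> bounds the drift at \<open>w\<close> up to time \<open>t\<close>. A vertex passes its bound on to distinct
  neighbours, so the bound at any vertex is at most a constant plus a constant multiple of the
  average over all vertices; this is what keeps the amplification bounded when \<open>n\<close> is linear in \<open>\<Delta>\<close>.
\<close>

primrec y :: "real \<Rightarrow> nat \<Rightarrow> nat \<Rightarrow> real" where
  "y \<beta> 0 w = \<beta>"
| "y \<beta> (Suc t) w = y \<beta> t w + (if w \<in> E t then 2 * b * y \<beta> t (other t w) else 0)"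

lemma y_nonneg: "0 \<le> \<beta> \<Longrightarrow> 0 \<le> y \<beta> t w"
  using b_pos by (induction t arbitrary: w) auto

lemma y_mono: "0 \<le> \<beta> \<Longrightarrow> s \<le> t \<Longrightarrow> y \<beta> s w \<le> y \<beta> t w"
proof (induction t)
  case (Suc t)
  have "0 \<le> 2 * b * y \<beta> t (other t w)" using Suc.prems y_nonneg b_pos by simp
  then show ?case using Suc by (auto simp: le_Suc_eq)
qed simp

lemma y_eq: "y \<beta> t w = \<beta> + 2 * b * (\<Sum>s\<in>nb t w. y \<beta> s (other s w))"
proof (induction t)
  case 0
  then show ?case by (simp add: nb_def)
next
  case (Suc t)
  then show ?case by (simp add: nb_Suc algebra_simps)
qed

lemma sum_y_other_le:
  "0 \<le> \<beta> \<Longrightarrow> t \<le> m \<Longrightarrow> (\<Sum>s\<in>nb t w. y \<beta> s (other s w)) \<le> (\<Sum>x<n. y \<beta> t x)"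
  by (rule sum_other_le) (auto intro: y_nonneg y_mono simp: nb_def)

lemma y_le: "0 \<le> \<beta> \<Longrightarrow> t \<le> m \<Longrightarrow> y \<beta> t w \<le> \<beta> + 2 * b * (\<Sum>x<n. y \<beta> t x)"
  using sum_y_other_le[of \<beta> t w] b_pos by (subst y_eq) auto

text \<open>An edge changes \<open>y\<close> at two vertices only, at each by at most
  \<open>2 * b\<close> times the left-hand side (\<open>y_le\<close>). So the left-hand side grows
  by a factor of at most \<open>1 + 8 * b\<^sup>2\<close> per step.\<close>

lemma sum_y_bound:
  assumes "0 \<le> \<beta>" "t \<le> m"
  shows "\<beta> + 2 * b * (\<Sum>x<n. y \<beta> t x) \<le> \<beta> * (1 + 2 * b * n) * (1 + 8 * b\<^sup>2) ^ t"
  using assms(2)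
proof (induction t)
  case 0
  then show ?case by (simp add: algebra_simps)
next
  case (Suc t)
  let ?L = "\<lambda>t. \<Sum>x<n. y \<beta> t x"
  let ?Z = "\<beta> + 2 * b * ?L t"
  have t: "t < m" "t \<le> m" using Suc.prems by auto
  have Z: "0 \<le> ?Z" using assms(1) b_pos y_nonneg by (simp add: sum_nonneg)
  have "(\<Sum>x<n. if x \<in> E t then 2 * b * y \<beta> t (other t x) else 0) \<le> 4 * b * ?Z"
    using t(1)
  proof (cases rule: edge_cases)
    case 1
    then show ?thesis using Z b_pos by simp
  next
    case (2 u v)
    have "(\<Sum>x<n. if x \<in> E t then 2 * b * y \<beta> t (other t x) else 0) =
        (\<Sum>x\<in>E t. 2 * b * y \<beta> t (other t x))"
      using 2 by (intro sum.mono_neutral_cong_right) auto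
    also have "\<dots> \<le> (\<Sum>x\<in>E t. 2 * b * ?Z)"
      using y_le[OF assms(1) t(2)] b_pos by (intro sum_mono mult_left_mono) auto
    also have "\<dots> = 4 * b * ?Z" using 2 by simp
    finally show ?thesis .
  qed
  then have "?L (Suc t) \<le> ?L t + 4 * b * ?Z"
    by (simp add: sum.distrib)
  then have "2 * b * ?L (Suc t) \<le> 2 * b * (?L t + 4 * b * ?Z)"
    using b_pos by (intro mult_left_mono) auto
  then have "\<beta> + 2 * b * ?L (Suc t) \<le> ?Z * (1 + 8 * b\<^sup>2)"
    by (simp add: algebra_simps power2_eq_square)
  also have "\<dots> \<le> \<beta> * (1 + 2 * b * n) * (1 + 8 * b\<^sup>2) ^ t * (1 + 8 * b\<^sup>2)"
    using Suc.IH t by (intro mult_right_mono) auto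
  finally show ?case by (simp add: mult_ac)
qed

end

section \<open>Histories with small noise\<close>

text \<open>
  The sets \<open>{c \<in> \<Gamma>. T < r c}\<close>, \<open>T = 0, 1, \<dots>\<close>, are the members of an arbitrary decreasing chain;
  letting the stopping time \<open>T x\<close> of a vertex select the member tested against it keeps the number
  of choices at \<open>exp (O(\<Delta> log \<Delta>))\<close>.
\<close>

locale good_history = legal_history +
  fixes M \<nu> :: real
  assumes M: "0 < M" and nu: "0 \<le> \<nu>"
    and n_le: "real n \<le> M * \<Delta>" and m_le: "real (length h) \<le> M * (real \<Delta>)\<^sup>2 / 2"
    and nu_le: "\<nu> * (1 + (1 + 12 * M / \<epsilon>\<^sup>2) * exp (144 * M / \<epsilon> ^ 4)) \<le> \<epsilon> ^ 3 / 288"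
    and chain_noise: "\<And>T r. \<lbrakk>\<And>x. T x \<le> length h; \<And>c. r c \<le> Suc (length h)\<rbrakk> \<Longrightarrow>
       (\<Sum>x<n. \<bar>noise \<Gamma> (vstat \<Gamma> x (T x) {c\<in>\<Gamma>. T x < r c}) h\<bar>) \<le> \<nu> * \<Delta>"
    and pair_noise: "\<And>u v t. \<lbrakk>u < n; v < n; u \<noteq> v; t \<le> length h\<rbrakk> \<Longrightarrow>
       \<bar>noise \<Gamma> (pstat \<Gamma> u v t) h\<bar> \<le> 1 / (24 * \<Delta>)"
begin

text \<open>Bounds \<open>(1 + 2 * b * n) * (1 + 8 * b\<^sup>2) ^ m\<close>; it is free of
  \<open>n\<close> and \<Delta> because \<open>b\<close> is of order 1 / \<Delta> while
  \<open>n\<close> and \<open>m\<close> are at most of order \<Delta> and \<Delta>^2.\<close>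

definition "A = (1 + 12 * M / \<epsilon>\<^sup>2) * exp (144 * M / \<epsilon> ^ 4)"
text \<open>The noise of the two chains in \<open>drift_le\<close>, each at most \<nu> \<Delta>,
  times \<open>b\<close>.\<close>

definition "\<beta> = 2 * b * \<nu> * \<Delta>"

lemma beta_nonneg: "0 \<le> \<beta>"
  using b_pos nu by (simp add: \<beta>_def)

lemma bn_le: "2 * b * n \<le> 12 * M / \<epsilon>\<^sup>2"
proof -
  have "2 * b * n \<le> 2 * b * (M * \<Delta>)" using n_le b_pos by (intro mult_left_mono) auto
  also have "\<dots> = 12 * M / \<epsilon>\<^sup>2" using Delta by (simp add: b_def)
  finally show ?thesis .
qed

lemma bm_le: "8 * b\<^sup>2 * m \<le> 144 * M / \<epsilon> ^ 4"
proof -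
  have "8 * b\<^sup>2 * m \<le> 8 * b\<^sup>2 * (M * (real \<Delta>)\<^sup>2 / 2)" using m_le by (intro mult_left_mono) auto
  also have "\<dots> = 144 * M / \<epsilon> ^ 4" using Delta eps
    by (simp add: b_def power_divide power_mult_distrib flip: power_mult)
  finally show ?thesis .
qed

lemma sum_y_le:
  assumes "t \<le> m"
  shows "(\<Sum>x<n. y \<beta> t x) \<le> \<nu> * \<Delta> * A"
proof -
  have "2 * b * (\<Sum>x<n. y \<beta> t x) \<le> \<beta> + 2 * b * (\<Sum>x<n. y \<beta> t x)"
    using beta_nonneg by simp
  also have "\<dots> \<le> \<beta> * (1 + 2 * b * n) * (1 + 8 * b\<^sup>2) ^ t"
    by (rule sum_y_bound[OF beta_nonneg assms])
  also have "\<dots> \<le> \<beta> * (1 + 12 * M / \<epsilon>\<^sup>2) * exp (144 * M / \<epsilon> ^ 4)"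
  proof (intro mult_mono mult_left_mono)
    have "(1 + 8 * b\<^sup>2) ^ t \<le> (exp (8 * b\<^sup>2)) ^ t"
      by (intro power_mono) auto
    also have "\<dots> = exp (8 * b\<^sup>2 * t)" by (simp add: exp_of_nat_mult[symmetric] mult.commute)
    also have "8 * b\<^sup>2 * t \<le> 8 * b\<^sup>2 * m" using assms by (intro mult_left_mono) auto
    then have "exp (8 * b\<^sup>2 * t) \<le> exp (144 * M / \<epsilon> ^ 4)" using bm_le by simp
    finally show "(1 + 8 * b\<^sup>2) ^ t \<le> exp (144 * M / \<epsilon> ^ 4)" .
  qed (use bn_le beta_nonneg M b_pos in auto)
  also have "\<dots> = 2 * b * (\<nu> * \<Delta> * A)" by (simp add: \<beta>_def A_def)
  finally show ?thesis using b_pos by simp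
qed

lemma chain_nz_le:
  assumes t: "t \<le> m" and D: "\<And>s. D s \<subseteq> \<Gamma>" and anti: "\<And>s s'. s \<le> s' \<Longrightarrow> s' \<le> m \<Longrightarrow> D s' \<subseteq> D s"
  shows "(\<Sum>s\<in>nb t w. \<bar>nz (other s w) s (D s)\<bar>) \<le> \<nu> * \<Delta>"
proof -
  \<comment> \<open>Each neighbour gets the time of its edge to \<open>w\<close>, unique since the
    graph is simple. For other vertices the value 0 makes \<open>vstat\<close> vanish.\<close>
  define T where "T x = (if x \<in> (\<lambda>s. other s w) ` nb t w
    then the_inv_into (nb t w) (\<lambda>s. other s w) x else 0)" for x
  have T: "T (other s w) = s" if "s \<in> nb t w" for s
    using that by (simp add: T_def the_inv_into_f_f[OF inj_on_other[OF t]])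
  have T_le: "T x \<le> m" for x
    using T nb_m[OF t] unfolding T_def by (fastforce simp: the_inv_into_f_f[OF inj_on_other[OF t]])
  \<comment> \<open>As the chain decreases, the times up to \<open>m\<close> with \<open>c\<close>
    in \<open>D s\<close> form an initial segment of length \<open>r c\<close>, possibly all
    \<open>m + 1\<close> of them.\<close>
  define r where "r c = card {s. s \<le> m \<and> c \<in> D s}" for c
  have r: "{s. s \<le> m \<and> c \<in> D s} = {..<r c}" for c
    unfolding r_def by (rule down_closed_eq_lessThan_card) (use anti in force)+
  have r_le: "r c \<le> Suc m" for c
    using card_mono[of "{..m}" "{s. s \<le> m \<and> c \<in> D s}"] by (auto simp: r_def)
  have D_eq: "D s = {c \<in> \<Gamma>. s < r c}" if "s \<le> m" for s
    using r D that by (auto simp: set_eq_iff)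
  have "(\<Sum>s\<in>nb t w. \<bar>nz (other s w) s (D s)\<bar>) \<le>
      (\<Sum>x<n. \<bar>noise \<Gamma> (vstat \<Gamma> x (T x) {c\<in>\<Gamma>. T x < r c}) h\<bar>)"
  proof (rule sum_other_le[OF t])
    fix s assume s: "s \<in> nb t w"
    then have "s \<le> m" using nb_m[OF t] by fastforce
    with s show "\<bar>nz (other s w) s (D s)\<bar> \<le> \<bar>noise \<Gamma>
        (vstat \<Gamma> (other s w) (T (other s w)) {c \<in> \<Gamma>. T (other s w) < r c}) h\<bar>"
      by (simp add: T nz_def flip: D_eq)
  qed simp
  also have "\<dots> \<le> \<nu> * \<Delta>" by (rule chain_noise[OF T_le r_le])
  finally show ?thesis .
qed

lemma chain_er_le:
  assumes t: "t \<le> m" and D: "\<And>s. D s \<subseteq> \<Gamma>" and anti: "\<And>s s'. s \<le> s' \<Longrightarrow> s' \<le> m \<Longrightarrow> D s' \<subseteq> D s"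
    and drift: "\<And>s x D. s < t \<Longrightarrow> D \<subseteq> \<Gamma> \<Longrightarrow> \<bar>drift x s D\<bar> \<le> y \<beta> s x"
  shows "(\<Sum>s\<in>nb t w. \<bar>er s (other s w) (D s)\<bar>)
     \<le> \<nu> * \<Delta> + (\<Sum>s\<in>nb t w. y \<beta> s (other s w))"
proof -
  have "(\<Sum>s\<in>nb t w. \<bar>er s (other s w) (D s)\<bar>)
     \<le> (\<Sum>s\<in>nb t w. \<bar>nz (other s w) s (D s)\<bar> + y \<beta> s (other s w))"
  proof (rule sum_mono)
    fix s assume "s \<in> nb t w"
    then have s: "s \<le> m" "s < t" using nb_m[OF t] by fastforce+
    show "\<bar>er s (other s w) (D s)\<bar> \<le> \<bar>nz (other s w) s (D s)\<bar> + y \<beta> s (other s w)"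
      using er_eq_noise_plus_drift[where w = "other s w" and D = "D s", OF s(1) D]
        drift[where x = "other s w" and D = "D s", OF s(2) D]
      by linarith
  qed
  also have "\<dots> \<le> \<nu> * \<Delta> + (\<Sum>s\<in>nb t w. y \<beta> s (other s w))"
    using chain_nz_le[where D = D and w = w, OF t D anti] by (simp add: sum.distrib)
  finally show ?thesis .
qed

text \<open>Strong induction over all vertices and color sets at once, since the drift at
  \<open>w\<close> involves earlier errors of neighbours for the sets
  \<open>F s w \<inter> D\<close> and \<open>F s w\<close>. The two chain bounds add up to the
  recursion \<open>y_eq\<close>.\<close>

lemma drift_le_y:
  assumes "t \<le> m" "\<And>s. s < t \<Longrightarrow> good s" "D \<subseteq> \<Gamma>"
  shows "\<bar>drift w t D\<bar> \<le> y \<beta> t w"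
  using assms
proof (induction t arbitrary: w D rule: less_induct)
  case (less t)
  have IH: "\<bar>drift x s D\<bar> \<le> y \<beta> s x" if "s < t" "D \<subseteq> \<Gamma>" for s x D
    using that less.prems by (intro less.IH) auto
  have "\<bar>drift w t D\<bar> \<le> b * ((\<Sum>s\<in>nb t w. \<bar>er s (other s w) (F s w \<inter> D)\<bar>)
           + (\<Sum>s\<in>nb t w. \<bar>er s (other s w) (F s w)\<bar>))"
    by (intro drift_le less.prems)
  also have "\<dots> \<le> b * ((\<nu> * \<Delta> + (\<Sum>s\<in>nb t w. y \<beta> s (other s w)))
        + (\<nu> * \<Delta> + (\<Sum>s\<in>nb t w. y \<beta> s (other s w))))"
  proof (intro mult_left_mono add_mono chain_er_le less.prems IH)
    show "F s' w \<inter> D \<subseteq> F s w \<inter> D" if "s \<le> s'" for s s'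
      using F_antimono[OF that] by blast
  qed (use b_pos F_subset F_antimono less.prems in auto)
  also have "\<dots> = y \<beta> t w" by (subst y_eq) (simp add: \<beta>_def algebra_simps)
  finally show ?case .
qed

lemma chain_er_le':
  assumes t: "t \<le> m" and D: "\<And>s. D s \<subseteq> \<Gamma>" and anti: "\<And>s s'. s \<le> s' \<Longrightarrow> s' \<le> m \<Longrightarrow> D s' \<subseteq> D s"
    and good: "\<And>s. s < t \<Longrightarrow> good s"
  shows "(\<Sum>s\<in>nb t w. \<bar>er s (other s w) (D s)\<bar>) \<le> \<nu> * (1 + A) * \<Delta>"
proof -
  have "(\<Sum>s\<in>nb t w. \<bar>er s (other s w) (D s)\<bar>)
     \<le> \<nu> * \<Delta> + (\<Sum>s\<in>nb t w. y \<beta> s (other s w))"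
    using t good by (intro chain_er_le D anti drift_le_y) auto
  also have "\<dots> \<le> \<nu> * \<Delta> + \<nu> * \<Delta> * A"
    using sum_y_other_le[OF beta_nonneg t, of w] sum_y_le[OF t] by simp
  finally show ?thesis by (simp add: algebra_simps)
qed

subsection \<open>Pairs of vertices\<close>

text \<open>For independent random free sets this ratio would stay near its initial value
  \<open>1 / card \<Gamma>\<close>.\<close>

definition "R t u v = real (card (F t u \<inter> F t v)) / (f t u * f t v)"
definition "pdrift t u v = (\<Sum>s\<in>nb t u. if col s = None \<or> v \<in> E s then 0
   else (q s u (F s v) - prop s (F s v)) / (f s u - 1) / f s v)"
definition "pz t u v = noise \<Gamma> (pstat \<Gamma> u v t) h"

lemma pz_eq:
  assumes "t \<le> m"
  shows "pz t u v = (\<Sum>s\<in>nb t u. case col s of None \<Rightarrow> 0 | Some c \<Rightarrow>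
     if v \<in> E s then 0 else (prop s (F s v) - of_bool (c \<in> F s v)) / (f s u - 1) / f s v)"
  unfolding pz_def noise_def
proof (rule sum.mono_neutral_cong_right)
  show "nb t u \<subseteq> {..<m}" using assms by (auto simp: nb_def)
  show "\<forall>s\<in>{..<m} - nb t u. incr \<Gamma> (pstat \<Gamma> u v t) (take s h) (h ! s) = 0"
    by (auto simp: nb_def E_def incr_def pstat_def avg_def split: option.splits)
  fix s assume s: "s \<in> nb t u"
  then have sm: "s < m" using assms by (auto simp: nb_def)
  have p: "pstat \<Gamma> u v t (take s h) (E s) c =
      (if v \<in> E s then 0 else - of_bool (c \<in> F s v) / ((f s u - 1) * f s v))" for c
    using s sm by (simp add: pstat_def nb_def f_def F_def)
  have "avg \<Gamma> (pstat \<Gamma> u v t) (take s h) (E s) =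
      (if v \<in> E s then 0 else - prop s (F s v) / ((f s u - 1) * f s v))"
    unfolding avg_def p prop_def avail_def[symmetric]
    by (simp add: sum_negf flip: sum_divide_distrib)
  then show "incr \<Gamma> (pstat \<Gamma> u v t) (take s h) (h ! s) = (case col s of None \<Rightarrow> 0 | Some c \<Rightarrow>
     if v \<in> E s then 0 else (prop s (F s v) - of_bool (c \<in> F s v)) / (f s u - 1) / f s v)"
    using p by (auto simp: incr_def col_def E_def diff_divide_distrib split: option.splits)
qed simp

lemma R_commute: "R t u v = R t v u"
  by (simp add: R_def Int_commute mult.commute)

lemma R_Suc:
  assumes t: "t < m" and u: "u \<in> E t" and v: "v \<notin> E t"
  shows "R (Suc t) u v + (pz t u v + pdrift t u v) = R t u v + (pz (Suc t) u v + pdrift (Suc t) u v)"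
proof (cases "col t")
  case None
  then have "F (Suc t) u = F t u" "F (Suc t) v = F t v" using t by (auto simp: F_Suc)
  then show ?thesis using None t by (simp add: R_def f_def pz_eq pdrift_def nb_Suc)
next
  case (Some c)
  have Fv: "F (Suc t) v = F t v" "f (Suc t) v = f t v" using t v by (auto simp: F_Suc f_def)
  let ?a = "real (card (F t u \<inter> F t v))" and ?d = "of_bool (c \<in> F t v)"
  have "R (Suc t) u v = (?a - ?d) / (f t u - 1) / f t v"
    by (simp add: R_def Fv f_Suc[OF t u Some] card_F_Suc_Int[OF t u Some])
  also have "(?a - ?d) / (f t u - 1) = q t u (F t v) + (prop t (F t v) - ?d) / (f t u - 1)
        + (q t u (F t v) - prop t (F t v)) / (f t u - 1)"
    unfolding q_def by (rule quotient_step) (use f_pos f_pos' t u in auto)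
  finally have "R (Suc t) u v = R t u v + (prop t (F t v) - ?d) / (f t u - 1) / f t v
        + (q t u (F t v) - prop t (F t v)) / (f t u - 1) / f t v"
    by (simp add: add_divide_distrib R_def q_def)
  then show ?thesis using t u v Some by (simp add: pz_eq pdrift_def nb_Suc)
qed

text \<open>Before the edge \<open>{u, v}\<close> arrives, every edge meets at most one of
  \<open>u\<close> and \<open>v\<close>, so the changes split into two one-sided sums.\<close>

lemma R_eq:
  assumes "t \<le> m" "u \<noteq> v" "\<And>s. s < t \<Longrightarrow> E s \<noteq> {u, v}"
  shows "R t u v = 1 / card \<Gamma> + (pz t u v + pdrift t u v) + (pz t v u + pdrift t v u)"
  using assms(1,3)
proof (induction t)
  case 0
  show ?case using card_Gamma_pos
    by (simp add: R_def f_def F_0 pz_eq pdrift_def) (simp add: nb_def)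
next
  case (Suc t)
  then have t: "t < m" and IH:
    "R t u v = 1 / card \<Gamma> + (pz t u v + pdrift t u v) + (pz t v u + pdrift t v u)" by auto
  have no: "pz (Suc t) u v = pz t u v \<and> pdrift (Suc t) u v = pdrift t u v" if "u \<notin> E t" for u v
    using that t by (simp add: pz_eq pdrift_def nb_Suc)
  have "\<not> (u \<in> E t \<and> v \<in> E t)"
    using t by (cases rule: edge_cases) (use assms(2) Suc.prems(2)[of t] in auto)
  then consider "u \<in> E t" "v \<notin> E t" | "v \<in> E t" "u \<notin> E t" | "u \<notin> E t" "v \<notin> E t" by auto
  then show ?case
  proof cases
    case 1
    then show ?thesis using R_Suc[OF t 1] IH no[OF 1(2), of u] by simp
  next
    case 2
    then show ?thesis
      using R_Suc[OF t 2] IH no[OF 2(2), of v] R_commute[of _ u v] by simp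
  next
    case 3
    then have "R (Suc t) u v = R t u v" using t by (simp add: R_def f_def F_Suc)
    then show ?thesis using IH no 3 by simp
  qed
qed

text \<open>The sets \<open>F s u \<inter> F s v\<close> and \<open>F s u\<close> form decreasing
  chains, so \<open>chain_er_le'\<close> bounds both error sums; the constant 288 in
  \<open>nu_le\<close> is 12 * 24.\<close>

lemma pdrift_le:
  assumes t: "t \<le> m" and good: "\<And>s. s < t \<Longrightarrow> good s"
  shows "\<bar>pdrift t u v\<bar> \<le> 1 / (24 * \<Delta>)"
proof -
  let ?e1 = "\<lambda>s. \<bar>er s (other s u) (F s u \<inter> F s v)\<bar>" and ?e2 = "\<lambda>s. \<bar>er s (other s u) (F s u)\<bar>"
  have "\<bar>pdrift t u v\<bar> \<le> (\<Sum>s\<in>nb t u. b / (\<epsilon> * \<Delta>) * (?e1 s + ?e2 s))"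
    unfolding pdrift_def
  proof (intro order_trans[OF sum_abs] sum_mono)
    fix s assume "s \<in> nb t u"
    then have s: "s < m" "u \<in> E s" "s < t" using nb_m[OF t] by auto
    have "\<bar>(q s u (F s v) - prop s (F s v)) / (f s u - 1)\<bar> / f s v
        \<le> (b * (?e1 s + ?e2 s)) / (\<epsilon> * \<Delta>)"
      using drift_term_le[OF s(1,2) good[OF s(3)] F_subset, of s v] f_ge[of s v] s eD b_pos
      by (intro frac_le) auto
    moreover have "0 \<le> b / (\<epsilon> * \<Delta>) * (?e1 s + ?e2 s)" using b_pos eD by simp
    ultimately show "\<bar>if col s = None \<or> v \<in> E s then 0
        else (q s u (F s v) - prop s (F s v)) / (f s u - 1) / f s v\<bar>
          \<le> b / (\<epsilon> * \<Delta>) * (?e1 s + ?e2 s)"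
      using f_pos[of s v] s by (auto simp: abs_mult)
  qed
  also have "\<dots> = b / (\<epsilon> * \<Delta>) * ((\<Sum>s\<in>nb t u. ?e1 s) + (\<Sum>s\<in>nb t u. ?e2 s))"
    by (simp only: sum_distrib_left[symmetric] sum.distrib)
  also have "\<dots> \<le> b / (\<epsilon> * \<Delta>) * (\<nu> * (1 + A) * \<Delta> + \<nu> * (1 + A) * \<Delta>)"
  proof (intro mult_left_mono add_mono chain_er_le' t good)
    show "F s' u \<inter> F s' v \<subseteq> F s u \<inter> F s v" if "s \<le> s'" for s s'
      using F_antimono[OF that] by blast
  qed (use F_subset F_antimono b_pos eD in auto)
  also have "\<dots> = 12 * (\<nu> * (1 + A)) / (\<epsilon> ^ 3 * \<Delta>)"
    using Delta by (simp add: b_def power2_eq_square power3_eq_cube)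
  also have "\<dots> \<le> 12 * (\<epsilon> ^ 3 / 288) / (\<epsilon> ^ 3 * \<Delta>)"
    using nu_le eps by (intro divide_right_mono mult_left_mono) (auto simp: A_def)
  also have "\<dots> = 1 / (24 * \<Delta>)" using eps by simp
  finally show ?thesis .
qed

text \<open>If all earlier edges are good, two noises and two drifts move \<open>R\<close> by at
  most 4 / (24 \<Delta>) in total. As \<open>card \<Gamma> \<le> 3 * \<Delta>\<close>, this is at
  most half of \<open>1 / card \<Gamma>\<close>.\<close>

lemma all_good: "t < m \<Longrightarrow> good t"
proof (induction t rule: less_induct)
  case (less t)
  have good: "good s" if "s < t" for s using less that by auto
  show ?case unfolding good_def
  proof (intro allI impI)
    fix u v assume uv: "u \<noteq> v \<and> E t = {u, v}"
    have un: "u < n" "v < n" using less.prems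
      by (cases rule: edge_cases; use uv in \<open>auto simp: doubleton_eq_iff\<close>)+
    have t: "t \<le> m" using less.prems by simp
    have "E s \<noteq> {u, v}" if "s < t" for s using simple[OF that less.prems] uv by auto
    with uv have "R t u v = 1 / card \<Gamma> + (pz t u v + pdrift t u v) + (pz t v u + pdrift t v u)"
      by (intro R_eq t) auto
    moreover have "\<bar>pz t u v\<bar> \<le> 1 / (24 * \<Delta>)" "\<bar>pz t v u\<bar> \<le> 1 / (24 * \<Delta>)"
      unfolding pz_def using pair_noise[OF un _ t] pair_noise[OF un(2,1) _ t] uv by blast+
    moreover have "\<bar>pdrift t u v\<bar> \<le> 1 / (24 * \<Delta>)" "\<bar>pdrift t v u\<bar> \<le> 1 / (24 * \<Delta>)"
      by (intro pdrift_le t good; assumption)+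
    moreover have "4 * (1 / (24 * \<Delta>)) \<le> 1 / (2 * card \<Gamma>)"
      using card_le card_Gamma_pos Delta by (simp add: field_simps)
    moreover have "1 / (2 * card \<Gamma>) = 1 / card \<Gamma> - 1 / (2 * card \<Gamma>)" by simp
    ultimately have "1 / (2 * card \<Gamma>) \<le> R t u v" by linarith
    then show "f t u * f t v / (2 * card \<Gamma>) \<le> card (F t u \<inter> F t v)"
      using f_pos[OF t, of u] f_pos[OF t, of v] by (simp add: R_def field_simps)
  qed
qed

theorem wins: "colorer_wins h"
proof -
  have "col t \<noteq> None" if t: "t < m" for t
  proof
    assume "col t = None"
    then have av: "avail t = {}" by (rule col_None[OF t])
    from t show False
    proof (cases rule: edge_cases)
      case 1
      then have "avail t = \<Gamma>" by (simp add: avail_def available_def)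
      then show False using av card_Gamma_pos by simp
    next
      case (2 u v)
      then have "f t u * f t v / (2 * card \<Gamma>) \<le> card (avail t)"
        using all_good[OF t] by (auto simp: good_def avail_edge)
      moreover have "0 < f t u * f t v / (2 * card \<Gamma>)"
        using f_pos t card_Gamma_pos by simp
      ultimately show False using av by simp
    qed
  qed
  then show ?thesis
    unfolding colorer_wins_def col_def by (force simp: in_set_conv_nth)
qed

end

subsection \<open>Most histories are good\<close>

text \<open>Bounds the denominators in \<open>vstat\<close> and \<open>pstat\<close>, and the number
  of vertices affected, at the step just made; needed for the step bounds of
  \<open>noise_tail\<close>.\<close>

lemma (in legal_history) last_step_facts:
  assumes "h = h' @ [(e, r)]"
  shows "w \<in> e \<Longrightarrow> \<epsilon> * \<Delta> \<le> real (card (free_set \<Gamma> h' w)) - 1"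
    and "\<epsilon> * \<Delta> \<le> real (card (free_set \<Gamma> h' v))"
    and "card ({..<n} \<inter> e) \<le> 2"
proof -
  have h: "h ! length h' = (e, r)" "take (length h') h = h'" "length h' < m"
    by (simp_all add: assms)
  show "w \<in> e \<Longrightarrow> \<epsilon> * \<Delta> \<le> real (card (free_set \<Gamma> h' w)) - 1"
    using f_ge'[OF h(3), of w] by (simp add: h E_def F_def f_def)
  show "\<epsilon> * \<Delta> \<le> real (card (free_set \<Gamma> h' v))"
    using f_ge[of "length h'" v] h by (simp add: F_def f_def)
  have e: "E (length h') = e" by (simp add: E_def h)
  from h(3) show "card ({..<n} \<inter> e) \<le> 2"
    by (cases rule: edge_cases) (auto simp: e card_insert_if)
qed

section \<open>Tail estimates and union bounds\<close>

lemma union_tail: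
  fixes B :: real
  assumes "finite I" "\<And>i. i \<in> I \<Longrightarrow> measure_pmf.prob p {h. Q i h} \<le> B"
  shows "measure_pmf.prob p {h. \<exists>i\<in>I. Q i h} \<le> card I * B"
proof -
  have "measure_pmf.prob p {h. \<exists>i\<in>I. Q i h} = measure_pmf.prob p (\<Union>i\<in>I. {h. Q i h})"
    by (rule arg_cong[where f = "measure_pmf.prob p"]) auto
  also have "\<dots> \<le> (\<Sum>i\<in>I. measure_pmf.prob p {h. Q i h})"
    by (rule measure_UNION_le) (use assms in auto)
  also have "\<dots> \<le> (\<Sum>i\<in>I. B)" by (intro sum_mono assms)
  finally show ?thesis by simp
qed

locale dense_game =
  fixes n \<Delta> :: nat and \<epsilon> M :: real and B :: builder
  assumes eps: "0 < \<epsilon>" "\<epsilon> < 1" and M: "0 < M" and Delta: "0 < \<Delta>"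
    and n_le: "real n \<le> M * \<Delta>" and B: "builder_strategy n \<Delta> \<epsilon> B"
begin

abbreviation "\<Gamma> \<equiv> palette \<Delta> \<epsilon>"
abbreviation "m \<equiv> num_steps n \<Delta>"
abbreviation "P t \<equiv> play B (randomized_greedy \<Gamma>) t"

lemma finite_palette: "finite \<Gamma>"
  by (simp add: palette_def)

lemma card_palette: "(1 + \<epsilon>) * \<Delta> \<le> card \<Gamma>" "card \<Gamma> \<le> 3 * \<Delta>"
proof -
  have "0 \<le> (1 + \<epsilon>) * \<Delta>" using eps by simp
  moreover have "(1 + \<epsilon>) * \<Delta> \<le> 2 * real \<Delta>" using eps by (intro mult_right_mono) auto
  then have "\<lceil>(1 + \<epsilon>) * \<Delta>\<rceil> \<le> 3 * \<Delta>" by linarith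
  ultimately show "(1 + \<epsilon>) * \<Delta> \<le> card \<Gamma>" "card \<Gamma> \<le> 3 * \<Delta>"
    unfolding palette_def card_lessThan by linarith+
qed

lemma m_le: "real m \<le> M * (real \<Delta>)\<^sup>2 / 2"
proof -
  have "real m \<le> real \<Delta> * n / 2" unfolding num_steps_def by (rule of_nat_floor) simp
  also have "\<dots> \<le> real \<Delta> * (M * \<Delta>) / 2" using n_le by (intro divide_right_mono mult_left_mono) auto
  finally show ?thesis by (simp add: power2_eq_square mult_ac)
qed

lemma legal_history_play: "t \<le> m \<Longrightarrow> h \<in> set_pmf (P t) \<Longrightarrow> legal_history n \<Delta> \<Gamma> \<epsilon> h"
  using legal_if_in_play[OF B] card_palette eps Delta finite_palette by unfold_locales auto

lemma length_play: "h \<in> set_pmf (P t) \<Longrightarrow> length h = t"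
  using consistent_if_in_play[OF finite_palette] by blast

lemma legal_history_snoc:
  assumes "t < m" "h \<in> set_pmf (P t)" "c \<in> available \<Gamma> h (B h)"
  shows "legal_history n \<Delta> \<Gamma> \<epsilon> (h @ [(B h, Some c)])"
proof (rule legal_history_play)
  show "h @ [(B h, Some c)] \<in> set_pmf (P (Suc t))"
    using assms by (auto simp: set_pmf_randomized_greedy[OF finite_palette] colorer_move_def
        intro!: bexI[of _ h])
qed (use assms in auto)

text \<open>Fixed signs replace the absolute values, making the statistic linear. A step affects at
  most two vertices, so it moves the sum by at most 2 / (\<epsilon> \<Delta>); over at most M
  \<Delta>^2 / 2 steps the squares sum to a constant.\<close>

lemma chain_tail:
  fixes \<nu> :: real
  assumes "\<nu> > 0" and \<sigma>: "\<And>x. x < n \<Longrightarrow> \<bar>\<sigma> x\<bar> \<le> 1"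
  shows "measure_pmf.prob (P m) {h. (\<Sum>x<n. \<sigma> x * noise \<Gamma> (vstat \<Gamma> x (T x) (D x)) h) \<ge> \<nu> * \<Delta>}
    \<le> exp (- (\<nu>\<^sup>2 * \<epsilon>\<^sup>2 / (4 * M) * (real \<Delta>)\<^sup>2))"
proof -
  let ?g = "\<lambda>h e c. \<Sum>x<n. \<sigma> x * vstat \<Gamma> x (T x) (D x) h e c"
  have "measure_pmf.prob (P m) {h. noise \<Gamma> ?g h \<ge> \<nu> * \<Delta>}
      \<le> exp (- ((\<nu> * \<Delta>)\<^sup>2 / (2 * (2 * M / \<epsilon>\<^sup>2))))"
  proof (rule noise_tail[OF finite_palette, where \<beta> = "\<lambda>_ _. 2 / (\<epsilon> * real \<Delta>)"])
    fix s h c assume s: "s < m" "h \<in> set_pmf (P s)" "c \<in> available \<Gamma> h (B h)"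
    interpret L: legal_history n \<Delta> \<Gamma> \<epsilon> "h @ [(B h, Some c)]"
      by (rule legal_history_snoc[OF s])
    note facts = L.last_step_facts[OF refl]
    have "\<bar>?g h (B h) c\<bar> \<le> (\<Sum>x<n. if x \<in> B h then 1 / (\<epsilon> * \<Delta>) else 0)"
    proof (intro order_trans[OF sum_abs] sum_mono)
      fix x assume x: "x \<in> {..<n}"
      have "\<bar>vstat \<Gamma> x (T x) (D x) h (B h) c\<bar> \<le> (if x \<in> B h then 1 / (\<epsilon> * \<Delta>) else 0)"
        using facts(1)[of x] L.eD by (auto simp: vstat_def abs_divide of_bool_def intro!: divide_left_mono)
      moreover have "\<bar>\<sigma> x\<bar> * \<bar>vstat \<Gamma> x (T x) (D x) h (B h) c\<bar>
          \<le> 1 * \<bar>vstat \<Gamma> x (T x) (D x) h (B h) c\<bar>"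
        using \<sigma> x by (intro mult_right_mono) auto
      ultimately show "\<bar>\<sigma> x * vstat \<Gamma> x (T x) (D x) h (B h) c\<bar>
          \<le> (if x \<in> B h then 1 / (\<epsilon> * \<Delta>) else 0)"
        by (simp add: abs_mult)
    qed
    also have "\<dots> = real (card ({..<n} \<inter> B h)) * (1 / (\<epsilon> * \<Delta>))"
      by (simp add: sum.If_cases)
    also have "\<dots> \<le> 2 * (1 / (\<epsilon> * \<Delta>))"
      using facts(3) L.eD by (intro mult_right_mono) auto
    finally show "\<bar>?g h (B h) c\<bar> \<le> 2 / (\<epsilon> * \<Delta>)" by simp
  next
    fix h assume h: "h \<in> set_pmf (P m)"
    have "(\<Sum>s<length h. (2 / (\<epsilon> * \<Delta>))\<^sup>2) = m * (2 / (\<epsilon> * \<Delta>))\<^sup>2"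
      using length_play[OF h] by simp
    also have "\<dots> \<le> M * (real \<Delta>)\<^sup>2 / 2 * (2 / (\<epsilon> * \<Delta>))\<^sup>2"
      by (intro mult_right_mono m_le) auto
    also have "\<dots> = 2 * M / \<epsilon>\<^sup>2" using Delta by (simp add: power2_eq_square)
    finally show "(\<Sum>s<length h. (2 / (\<epsilon> * \<Delta>))\<^sup>2) \<le> 2 * M / \<epsilon>\<^sup>2" .
  qed (use assms M Delta eps in auto)
  also have "(\<nu> * \<Delta>)\<^sup>2 / (2 * (2 * M / \<epsilon>\<^sup>2)) = \<nu>\<^sup>2 * \<epsilon>\<^sup>2 / (4 * M) * (real \<Delta>)\<^sup>2"
    by (simp add: power_mult_distrib)
  finally show ?thesis by (simp add: noise_sum noise_scale)
qed

text \<open>Only the at most \<Delta> edges at \<open>u\<close> count, each contributing at most 1 /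
  (\<epsilon> \<Delta>)^2. Hence \<open>V\<close> is 1 / (\<epsilon>^4 \<Delta>^3), and a deviation
  of order 1 / \<Delta> has exponent linear in \<Delta>.\<close>

lemma pair_tail:
  assumes \<sigma>: "\<bar>\<sigma>\<bar> \<le> (1::real)"
  shows "measure_pmf.prob (P m) {h. \<sigma> * noise \<Gamma> (pstat \<Gamma> u v t) h \<ge> 1 / (24 * \<Delta>)}
    \<le> exp (- (\<epsilon> ^ 4 / 1152 * \<Delta>))"
proof -
  let ?g = "\<lambda>h e c. \<sigma> * pstat \<Gamma> u v t h e c"
  define V where "V = \<Delta> * (1 / (\<epsilon> * \<Delta>)\<^sup>2)\<^sup>2"
  have "measure_pmf.prob (P m) {h. noise \<Gamma> ?g h \<ge> 1 / (24 * real \<Delta>)}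
      \<le> exp (- ((1 / (24 * real \<Delta>))\<^sup>2 / (2 * V)))"
  proof (rule noise_tail[OF finite_palette,
        where \<beta> = "\<lambda>_ e. if u \<in> e then 1 / (\<epsilon> * \<Delta>)\<^sup>2 else 0"])
    fix s h c assume s: "s < m" "h \<in> set_pmf (P s)" "c \<in> available \<Gamma> h (B h)"
    interpret L: legal_history n \<Delta> \<Gamma> \<epsilon> "h @ [(B h, Some c)]"
      by (rule legal_history_snoc[OF s])
    note facts = L.last_step_facts[OF refl]
    let ?d = "(real (card (free_set \<Gamma> h u)) - 1) * real (card (free_set \<Gamma> h v))"
    have d: "(\<epsilon> * \<Delta>)\<^sup>2 \<le> ?d" if "u \<in> B h"
      unfolding power2_eq_square using facts(1)[OF that] facts(2)[of v] L.eD by (intro mult_mono) auto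
    have d0: "0 < (\<epsilon> * \<Delta>)\<^sup>2" using L.eD by (rule zero_less_power)
    have "\<bar>pstat \<Gamma> u v t h (B h) c\<bar> \<le> (if u \<in> B h then 1 / (\<epsilon> * \<Delta>)\<^sup>2 else 0)"
    proof (cases "u \<in> B h")
      case True
      then have "\<bar>pstat \<Gamma> u v t h (B h) c\<bar> \<le> 1 / \<bar>?d\<bar>"
        unfolding pstat_def by (auto simp: abs_divide simp del: abs_mult)
      also have "\<dots> \<le> 1 / (\<epsilon> * \<Delta>)\<^sup>2"
        by (rule frac_le[OF zero_le_one order_refl d0 order_trans[OF d[OF True] abs_ge_self]])
      finally show ?thesis using True by simp
    qed (simp add: pstat_def)
    moreover have "\<bar>\<sigma>\<bar> * \<bar>pstat \<Gamma> u v t h (B h) c\<bar> \<le> 1 * \<bar>pstat \<Gamma> u v t h (B h) c\<bar>"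
      using \<sigma> by (intro mult_right_mono) auto
    ultimately show "\<bar>?g h (B h) c\<bar> \<le> (if u \<in> B h then 1 / (\<epsilon> * \<Delta>)\<^sup>2 else 0)"
      by (simp add: abs_mult)
  next
    fix h assume h: "h \<in> set_pmf (P m)"
    interpret L: legal_history n \<Delta> \<Gamma> \<epsilon> h
      by (rule legal_history_play[OF order_refl h])
    have "(\<Sum>s<length h. (if u \<in> fst (h ! s) then 1 / (\<epsilon> * \<Delta>)\<^sup>2 else 0)\<^sup>2) =
        (\<Sum>s\<in>L.nb (length h) u. (1 / (\<epsilon> * \<Delta>)\<^sup>2)\<^sup>2)"
      by (rule sum.mono_neutral_cong_right) (auto simp: L.nb_def L.E_def)
    also have "\<dots> \<le> V"
      unfolding V_def using L.card_nb_le[of "length h" u] by (simp add: mult_right_mono)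
    finally show "(\<Sum>s<length h. (if u \<in> fst (h ! s) then 1 / (\<epsilon> * \<Delta>)\<^sup>2 else 0)\<^sup>2) \<le> V" .
  qed (use Delta eps in \<open>auto simp: V_def\<close>)
  also have "(1 / (24 * real \<Delta>))\<^sup>2 / (2 * V) = \<epsilon> ^ 4 / 1152 * \<Delta>"
    using Delta eps by (simp add: V_def field_simps power2_eq_square power4_eq_xxxx)
  finally show ?thesis unfolding noise_scale by simp
qed

definition "bad_chain (\<nu>::real) h \<longleftrightarrow> (\<exists>T r. (\<forall>x. T x \<le> m) \<and> (\<forall>c. r c \<le> Suc m) \<and>
   \<nu> * \<Delta> < (\<Sum>x<n. \<bar>noise \<Gamma> (vstat \<Gamma> x (T x) {c\<in>\<Gamma>. T x < r c}) h\<bar>))"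
definition "bad_pair h \<longleftrightarrow> (\<exists>u<n. \<exists>v<n. \<exists>t\<le>m. 1 / (24 * \<Delta>) < \<bar>noise \<Gamma> (pstat \<Gamma> u v t) h\<bar>)"

lemma prob_bad_chain:
  assumes "\<nu> > 0"
  shows "measure_pmf.prob (P m) {h. bad_chain \<nu> h}
     \<le> real ((m + 1) ^ n * (m + 2) ^ card \<Gamma> * 2 ^ n) * exp (- (\<nu>\<^sup>2 * \<epsilon>\<^sup>2 / (4 * M) * (real \<Delta>)\<^sup>2))"
proof -
  define I where "I = ({..<n} \<rightarrow>\<^sub>E {..m}) \<times> (\<Gamma> \<rightarrow>\<^sub>E {..Suc m}) \<times> ({..<n} \<rightarrow>\<^sub>E {-1, 1::real})"
  define Q where "Q = (\<lambda>(T, r, \<sigma>) h. \<nu> * \<Delta> \<le>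
     (\<Sum>x<n. \<sigma> x * noise \<Gamma> (vstat \<Gamma> x (T x) {c\<in>\<Gamma>. T x < r c}) h))"
  have card_I: "card I = (m + 1) ^ n * (m + 2) ^ card \<Gamma> * 2 ^ n"
    using finite_palette by (simp add: I_def card_cartesian_product card_PiE numeral_2_eq_2)
  have "{h. bad_chain \<nu> h} \<subseteq> {h. \<exists>i\<in>I. Q i h}"
  proof (intro subsetI CollectI)
    fix h assume "h \<in> {h. bad_chain \<nu> h}"
    then obtain T r where T: "\<And>x. T x \<le> m" and r: "\<And>c. r c \<le> Suc m" and
      big: "\<nu> * \<Delta> < (\<Sum>x<n. \<bar>noise \<Gamma> (vstat \<Gamma> x (T x) {c\<in>\<Gamma>. T x < r c}) h\<bar>)"
      by (auto simp: bad_chain_def)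
    \<comment> \<open>Restricting to the relevant vertices and colors leaves finitely many triples;
      the signs below recover the absolute values.\<close>
    define T' where "T' = restrict T {..<n}"
    define r' where "r' = restrict r \<Gamma>"
    define \<sigma> where "\<sigma> = restrict (\<lambda>x. if noise \<Gamma> (vstat \<Gamma> x (T x) {c\<in>\<Gamma>. T x < r c}) h < 0
      then -1 else 1::real) {..<n}"
    have "(T', r', \<sigma>) \<in> I" using T r by (auto simp: I_def T'_def r'_def \<sigma>_def)
    moreover have r': "{c\<in>\<Gamma>. k < r' c} = {c\<in>\<Gamma>. k < r c}" for k by (auto simp: r'_def)
    have "(\<Sum>x<n. \<sigma> x * noise \<Gamma> (vstat \<Gamma> x (T' x) {c\<in>\<Gamma>. T' x < r' c}) h) =
        (\<Sum>x<n. \<bar>noise \<Gamma> (vstat \<Gamma> x (T x) {c\<in>\<Gamma>. T x < r c}) h\<bar>)"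
      by (intro sum.cong refl) (simp add: r' T'_def \<sigma>_def)
    then have "Q (T', r', \<sigma>) h" using big by (simp add: Q_def)
    ultimately show "\<exists>i\<in>I. Q i h" by blast
  qed
  then have "measure_pmf.prob (P m) {h. bad_chain \<nu> h} \<le> measure_pmf.prob (P m) {h. \<exists>i\<in>I. Q i h}"
    by (intro measure_pmf.finite_measure_mono) auto
  also have "\<dots> \<le> card I * exp (- (\<nu>\<^sup>2 * \<epsilon>\<^sup>2 / (4 * M) * (real \<Delta>)\<^sup>2))"
  proof (rule union_tail)
    show "finite I" unfolding I_def using finite_palette by (intro finite_cartesian_product finite_PiE) auto
    fix i assume i: "i \<in> I"
    obtain T r \<sigma> where i_eq: "i = (T, r, \<sigma>)" by (cases i)
    have "\<bar>\<sigma> x\<bar> \<le> 1" if "x < n" for x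
      using i that unfolding i_eq I_def by (auto dest!: PiE_mem[of _ _ _ x])
    then show "measure_pmf.prob (P m) {h. Q i h} \<le> exp (- (\<nu>\<^sup>2 * \<epsilon>\<^sup>2 / (4 * M) * (real \<Delta>)\<^sup>2))"
      unfolding i_eq Q_def prod.case by (rule chain_tail[OF assms])
  qed
  finally show ?thesis unfolding card_I by simp
qed

lemma prob_bad_pair:
  "measure_pmf.prob (P m) {h. bad_pair h} \<le> real (n * n * (m + 1) * 2) * exp (- (\<epsilon> ^ 4 / 1152 * \<Delta>))"
proof -
  define I where "I = {..<n} \<times> {..<n} \<times> {..m} \<times> {-1, 1::real}"
  define Q where "Q = (\<lambda>(u, v, t, \<sigma>) h. 1 / (24 * \<Delta>) \<le> \<sigma> * noise \<Gamma> (pstat \<Gamma> u v t) h)"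
  have card_I: "card I = n * n * (m + 1) * 2"
    by (simp add: I_def card_cartesian_product algebra_simps)
  have "{h. bad_pair h} \<subseteq> {h. \<exists>i\<in>I. Q i h}"
  proof (intro subsetI CollectI)
    fix h assume "h \<in> {h. bad_pair h}"
    then obtain u v t where uvt: "u < n" "v < n" "t \<le> m"
      and big: "1 / (24 * \<Delta>) < \<bar>noise \<Gamma> (pstat \<Gamma> u v t) h\<bar>"
      by (auto simp: bad_pair_def)
    show "\<exists>i\<in>I. Q i h"
    proof (cases "noise \<Gamma> (pstat \<Gamma> u v t) h < 0")
      case True
      then have "(u, v, t, -1) \<in> I \<and> Q (u, v, t, -1) h" using uvt big by (simp add: I_def Q_def)
      then show ?thesis by blast
    next
      case False
      then have "(u, v, t, 1) \<in> I \<and> Q (u, v, t, 1) h" using uvt big by (simp add: I_def Q_def)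
      then show ?thesis by blast
    qed
  qed
  then have "measure_pmf.prob (P m) {h. bad_pair h} \<le> measure_pmf.prob (P m) {h. \<exists>i\<in>I. Q i h}"
    by (intro measure_pmf.finite_measure_mono) auto
  also have "\<dots> \<le> card I * exp (- (\<epsilon> ^ 4 / 1152 * \<Delta>))"
  proof (rule union_tail)
    show "finite I" unfolding I_def by simp
    fix i assume i: "i \<in> I"
    obtain u v t \<sigma> where i_eq: "i = (u, v, t, \<sigma>)" by (cases i)
    have "\<bar>\<sigma>\<bar> \<le> 1" using i unfolding i_eq I_def by auto
    then show "measure_pmf.prob (P m) {h. Q i h} \<le> exp (- (\<epsilon> ^ 4 / 1152 * \<Delta>))"
      unfolding i_eq Q_def prod.case by (rule pair_tail)
  qed
  finally show ?thesis unfolding card_I by simp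
qed

lemma not_wins_imp_bad:
  assumes "\<nu> > 0"
    and "\<nu> * (1 + (1 + 12 * M / \<epsilon>\<^sup>2) * exp (144 * M / \<epsilon> ^ 4)) \<le> \<epsilon> ^ 3 / 288"
    and h: "h \<in> set_pmf (P m)" "\<not> colorer_wins h"
  shows "bad_chain \<nu> h \<or> bad_pair h"
proof (rule ccontr)
  assume ok: "\<not> (bad_chain \<nu> h \<or> bad_pair h)"
  interpret L: legal_history n \<Delta> \<Gamma> \<epsilon> h
    by (rule legal_history_play[OF order_refl h(1)])
  have "good_history n \<Delta> \<Gamma> \<epsilon> h M \<nu>"
  proof
    fix T r :: "nat \<Rightarrow> nat"
    assume "\<And>x. T x \<le> length h" "\<And>c. r c \<le> Suc (length h)"
    then show "(\<Sum>x<n. \<bar>noise \<Gamma> (vstat \<Gamma> x (T x) {c \<in> \<Gamma>. T x < r c}) h\<bar>) \<le> \<nu> * \<Delta>"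
      using ok unfolding bad_chain_def length_play[OF h(1)] not_less[symmetric] by blast
  next
    fix u v t
    assume "u < n" "v < n" "t \<le> length h"
    then show "\<bar>noise \<Gamma> (pstat \<Gamma> u v t) h\<bar> \<le> 1 / (24 * \<Delta>)"
      using ok unfolding bad_pair_def length_play[OF h(1)] not_less[symmetric] by blast
  qed (use assms M n_le m_le length_play[OF h(1)] in auto)
  then show False using good_history.wins h(2) by blast
qed

theorem prob_wins:
  assumes "\<nu> > 0"
    and "\<nu> * (1 + (1 + 12 * M / \<epsilon>\<^sup>2) * exp (144 * M / \<epsilon> ^ 4)) \<le> \<epsilon> ^ 3 / 288"
  shows "measure_pmf.prob (P m) {h. colorer_wins h} \<ge> 1 -
    ((M * (real \<Delta>)\<^sup>2 + 4) powr ((M + 3) * \<Delta>) * exp (- (\<nu>\<^sup>2 * \<epsilon>\<^sup>2 / (4 * M) * (real \<Delta>)\<^sup>2))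
     + (M * \<Delta>)\<^sup>2 * (M * (real \<Delta>)\<^sup>2 + 4) * exp (- (\<epsilon> ^ 4 / 1152 * \<Delta>)))"
proof -
  \<comment> \<open>One base for all counts: it dominates \<open>2 * (m + 2)\<close>, and the
    exponent satisfies \<open>n + card \<Gamma> \<le> (M + 3) * \<Delta>\<close>.\<close>
  let ?X = "M * (real \<Delta>)\<^sup>2 + 4"
  let ?e1 = "exp (- (\<nu>\<^sup>2 * \<epsilon>\<^sup>2 / (4 * M) * (real \<Delta>)\<^sup>2))" and ?e2 = "exp (- (\<epsilon> ^ 4 / 1152 * \<Delta>))"
  have m2: "2 * (real m + 2) \<le> ?X" using m_le by simp
  have "1 - measure_pmf.prob (P m) {h. colorer_wins h} = measure_pmf.prob (P m) {h. \<not> colorer_wins h}"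
    using measure_pmf.prob_compl[of "{h. colorer_wins h}" "P m"]
    by (simp add: Compl_eq_Diff_UNIV[symmetric] Collect_neg_eq)
  also have "\<dots> \<le> measure_pmf.prob (P m) ({h. bad_chain \<nu> h} \<union> {h. bad_pair h})"
    by (rule measure_pmf.finite_measure_mono_AE)
       (use not_wins_imp_bad[OF assms] in \<open>auto simp: AE_measure_pmf_iff\<close>)
  also have "\<dots> \<le> measure_pmf.prob (P m) {h. bad_chain \<nu> h} + measure_pmf.prob (P m) {h. bad_pair h}"
    by (rule measure_subadditive) auto
  also have "\<dots> \<le> real ((m + 1) ^ n * (m + 2) ^ card \<Gamma> * 2 ^ n) * ?e1 + real (n * n * (m + 1) * 2) * ?e2"
    by (intro add_mono prob_bad_chain prob_bad_pair assms)
  also have "\<dots> \<le> ?X powr ((M + 3) * \<Delta>) * ?e1 + (M * \<Delta>)\<^sup>2 * ?X * ?e2"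
  proof (intro add_mono mult_right_mono)
    have "real ((m + 1) ^ n * (m + 2) ^ card \<Gamma> * 2 ^ n) =
        (real m + 1) ^ n * (real m + 2) ^ card \<Gamma> * 2 ^ n"
      by (simp add: add.commute)
    also have "\<dots> = (2 * (real m + 1)) ^ n * (real m + 2) ^ card \<Gamma>"
      by (simp only: power_mult_distrib mult_ac)
    also have "\<dots> \<le> ?X ^ n * ?X ^ card \<Gamma>"
      using m2 by (intro mult_mono power_mono) auto
    also have "\<dots> = ?X powr (real n + card \<Gamma>)"
      using M by (simp add: powr_add powr_realpow add_nonneg_pos)
    also have "\<dots> \<le> ?X powr ((M + 3) * \<Delta>)"
      using n_le card_palette(2) M by (intro powr_mono) (auto simp: algebra_simps)
    finally show "real ((m + 1) ^ n * (m + 2) ^ card \<Gamma> * 2 ^ n) \<le> ?X powr ((M + 3) * \<Delta>)" .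
    have "real (n * n * (m + 1) * 2) = (real n)\<^sup>2 * (2 * (real m + 1))"
      by (simp add: power2_eq_square algebra_simps)
    also have "\<dots> \<le> (M * \<Delta>)\<^sup>2 * ?X"
      using m2 n_le by (intro mult_mono power_mono) auto
    finally show "real (n * n * (m + 1) * 2) \<le> (M * \<Delta>)\<^sup>2 * ?X" .
  qed auto
  finally show ?thesis by linarith
qed

end

section \<open>Asymptotics of the failure probability\<close>

lemma eventually_failure_le:
  fixes M \<kappa> \<eta> :: real
  assumes "0 < M" "0 < \<kappa>" "0 < \<eta>"
  shows "\<forall>\<^sub>F x in at_top. (M * x\<^sup>2 + 4) powr ((M + 3) * x) * exp (- (\<kappa> * x\<^sup>2))
     + (M * x)\<^sup>2 * (M * x\<^sup>2 + 4) * exp (- (\<eta> * x)) \<le> 2 powr (- (\<eta> / 2 * x))"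
proof -
  \<comment> \<open>Half of the exponent \<eta> is given up so that each summand is at most half of
    \<open>exp (- (\<eta> / 2 * x))\<close>; passing to base 2 then only uses ln 2 < 1.\<close>
  have "\<forall>\<^sub>F x in at_top. (M + 3) * x * ln (M * x\<^sup>2 + 4) - \<kappa> * x\<^sup>2 + \<eta> / 2 * x \<le> ln (1 / 2)"
    using assms by real_asymp
  moreover have "\<forall>\<^sub>F x in at_top. (M * x)\<^sup>2 * (M * x\<^sup>2 + 4) * exp (- (\<eta> / 2 * x)) \<le> 1 / 2"
    using assms by real_asymp
  moreover have "\<forall>\<^sub>F x::real in at_top. 0 \<le> x" by (rule eventually_ge_at_top)
  ultimately show ?thesis
  proof eventually_elim
    case (elim x)
    let ?X = "M * x\<^sup>2 + 4" and ?E = "exp (- (\<eta> / 2 * x))"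
    have X: "?X > 0" using assms by (simp add: add_nonneg_pos)
    have "?X powr ((M + 3) * x) * exp (- (\<kappa> * x\<^sup>2))
        = exp ((M + 3) * x * ln ?X - \<kappa> * x\<^sup>2 + \<eta> / 2 * x) * ?E"
      using X by (simp add: powr_def flip: exp_add)
    also have "\<dots> \<le> exp (ln (1 / 2)) * ?E"
      by (intro mult_right_mono exp_le_cancel_iff[THEN iffD2] elim(1)) auto
    finally have "?X powr ((M + 3) * x) * exp (- (\<kappa> * x\<^sup>2)) \<le> 1 / 2 * ?E" by simp
    moreover have "(M * x)\<^sup>2 * ?X * exp (- (\<eta> * x)) = (M * x)\<^sup>2 * ?X * ?E * ?E"
      by (simp add: mult.assoc flip: exp_add)
    moreover have "(M * x)\<^sup>2 * ?X * ?E * ?E \<le> 1 / 2 * ?E"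
      using elim(2) by (intro mult_right_mono) auto
    moreover have "\<eta> / 2 * x * ln 2 \<le> \<eta> / 2 * x * 1"
      using assms elim(3) ln_2_less_1 by (intro mult_left_mono) auto
    then have "?E \<le> 2 powr (- (\<eta> / 2 * x))" by (simp add: powr_def)
    ultimately show ?case by linarith
  qed
qed

theorem mainTheorem2:
  fixes \<epsilon> M :: real
  assumes "0 < \<epsilon>" and "\<epsilon> < 1" and "1 < M"
  shows "\<exists>\<gamma>>0. \<exists>N::nat. \<forall>n\<ge>N. \<forall>\<Delta>::nat. real \<Delta> > real n / M \<longrightarrow>
           (\<forall>B. builder_strategy n \<Delta> \<epsilon> B \<longrightarrow>
              measure_pmf.prob (game n \<Delta> B (randomized_greedy (palette \<Delta> \<epsilon>))) {h. colorer_wins h}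
                \<ge> 1 - 2 powr (- (\<gamma> * real \<Delta>)))"
proof -
  define K where "K = 1 + (1 + 12 * M / \<epsilon>\<^sup>2) * exp (144 * M / \<epsilon> ^ 4)"
  define \<nu> where "\<nu> = \<epsilon> ^ 3 / 288 / K"
  define \<eta> where "\<eta> = \<epsilon> ^ 4 / 1152"
  have "0 < K"
    unfolding K_def using assms by (intro add_pos_nonneg) auto
  then have nu: "0 < \<nu>" "\<nu> * (1 + (1 + 12 * M / \<epsilon>\<^sup>2) * exp (144 * M / \<epsilon> ^ 4)) \<le> \<epsilon> ^ 3 / 288"
    unfolding K_def[symmetric] using assms by (simp_all add: \<nu>_def)
  have "0 < \<nu>\<^sup>2 * \<epsilon>\<^sup>2 / (4 * M)" "0 < \<eta>" using nu assms by (auto simp: \<eta>_def)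
  from eventually_failure_le[OF _ this, of M] assms obtain x0 where x0:
    "\<And>x. x \<ge> x0 \<Longrightarrow> (M * x\<^sup>2 + 4) powr ((M + 3) * x) * exp (- (\<nu>\<^sup>2 * \<epsilon>\<^sup>2 / (4 * M) * x\<^sup>2))
     + (M * x)\<^sup>2 * (M * x\<^sup>2 + 4) * exp (- (\<eta> * x)) \<le> 2 powr (- (\<eta> / 2 * x))"
    by (auto simp: eventually_at_top_linorder)
  show ?thesis
  \<comment> \<open>With this threshold, \<open>n \<ge> M * x0\<close> and
    \<open>\<Delta> > n / M\<close> force \<Delta> above \<open>x0\<close>, so one asymptotic
    estimate in \<Delta> suffices.\<close>
  proof (intro exI[of _ "\<eta> / 2"] exI[of _ "nat \<lceil>M * x0\<rceil>"] conjI allI impI)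
    fix n \<Delta> :: nat and B
    assume n: "nat \<lceil>M * x0\<rceil> \<le> n" and D: "real n / M < real \<Delta>" and B: "builder_strategy n \<Delta> \<epsilon> B"
    have nD: "real n < M * \<Delta>" using D assms by (simp add: field_simps)
    then have "0 < M * \<Delta>" by linarith
    then have "0 < \<Delta>" using assms by (simp add: zero_less_mult_iff)
    then interpret dense_game n \<Delta> \<epsilon> M B
      using assms nD B by unfold_locales auto
    have "M * x0 < M * \<Delta>" using n nD by linarith
    then have "x0 \<le> \<Delta>" using assms by simp
    from x0[OF this] prob_wins[OF nu]
    show "1 - 2 powr (- (\<eta> / 2 * real \<Delta>)) \<le>
        measure_pmf.prob (game n \<Delta> B (randomized_greedy (palette \<Delta> \<epsilon>))) {h. colorer_wins h}"
      by (simp add: game_def \<eta>_def)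
  qed (use \<open>0 < \<eta>\<close> in auto)
qed

end
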